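(* Let $p$ be an odd prime, $H'_{p-1}=1+\frac13+\frac15+\dots+\frac1{p-2}$, $N_{p-2}$ the number of permutations of $p-2$ letters with an even number of ascents, and $A=\frac{pB_{p-1}+1}{p}$ the Agoh–Giuga quotient. Then, modulo $p$, $$(2N_{p-2})_0\equiv(H'_{p-1})_0+1,$$ $$(2N_{p-2})_1+\bigl((2N_{p-2})_0-1\bigr)_1\equiv\frac32(H'_{p-1})_0^2+(H'_{p-1})_1+(H'_{p-1})_0-A\bigl(1+(H'_{p-1})_0\bigr)+2.$$
   Context: For a $p$-adic integer $x$, write $x=\sum_{j\ge0}(x)_jp^j$ with digits $(x)_j\in\{0,\dots,p-1\}$; this applies in particular to $H'_{p-1}\in\mathbb{Z}_p$ and to the integer $(2N_{p-2})_0-1$. For a permutation $(i_1,\dots,i_n)$ of $\{1,\dots,n\}$, an ascent is an index $k$ with $i_{k+1}>i_k$.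
   Formalization: The second congruence is stated only for p ≠ 3, because it fails at p = 3: there N_1 = 1, H'_2 = 1 and A = 1/2, so the left side is 0 and the right side is 7/2 ≡ 2 mod 3; the first congruence is kept for all odd primes. *)

theory Defs
  imports Complex_Main "HOL-Number_Theory.Number_Theory" "HOL-Combinatorics.Permutations"
begin

(* All p-adic numbers below are rational, so instead of the full ring of p-adic integers
   its subring of rationals with denominator prime to p is used. *)
definition p_integers :: "nat \<Rightarrow> rat set" where
  "p_integers p = {of_int a / of_int b | a b. \<not> int p dvd b}"

(* Congruence of rationals modulo p^n, i.e. difference in p^n Z_p. *)
definition pcong :: "nat \<Rightarrow> nat \<Rightarrow> rat \<Rightarrow> rat \<Rightarrow> bool" where
  "pcong p n x y \<longleftrightarrow> (\<exists>z \<in> p_integers p. x - y = of_nat p ^ n * z)"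

(* d is the digit sequence of x: the partial sums of d j * p^j converge p-adically to x. *)
definition padic_expansion :: "nat \<Rightarrow> rat \<Rightarrow> (nat \<Rightarrow> nat) \<Rightarrow> bool" where
  "padic_expansion p x d \<longleftrightarrow>
     (\<forall>j. d j < p) \<and> (\<forall>n. pcong p n x (\<Sum>j<n. of_nat (d j) * of_nat p ^ j))"

definition padic_digit :: "nat \<Rightarrow> rat \<Rightarrow> nat \<Rightarrow> nat" where
  "padic_digit p x = (THE d. padic_expansion p x d)"

definition odd_harmonic :: "nat \<Rightarrow> rat" where
  "odd_harmonic p = (\<Sum>k | odd k \<and> k \<le> p - 2. 1 / of_nat k)"

(* The permutation f of {1..n} is read as the word (f 1, ..., f n). *)
definition ascents :: "nat \<Rightarrow> (nat \<Rightarrow> nat) \<Rightarrow> nat set" where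
  "ascents n f = {k \<in> {1..<n}. f (k + 1) > f k}"

definition num_even_ascents :: "nat \<Rightarrow> nat" where
  "num_even_ascents n = card {f. f permutes {1..n} \<and> even (card (ascents n f))}"

(* B_0 = 1 and sum_{k=0}^n binomial(n+1,k) B_k = 0 for n > 0 *)
fun bernoulli :: "nat \<Rightarrow> rat" where
  "bernoulli n = (if n = 0 then 1
     else - (\<Sum>k<n. of_nat (Suc n choose k) * bernoulli k) / of_nat (Suc n))"

declare bernoulli.simps [simp del]

definition agoh_giuga :: "nat \<Rightarrow> rat" where
  "agoh_giuga p = (of_nat p * bernoulli (p - 1) + 1) / of_nat p"


lemma p_integers_of_int [simp]:
  assumes "prime p" shows "of_int a \<in> p_integers p"
proof -
  have "\<not> int p dvd 1" using assms by (auto dest: prime_gt_1_nat)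
  moreover have "of_int a = (of_int a / of_int 1 :: rat)" by simp
  ultimately show ?thesis unfolding p_integers_def by blast
qed

lemma p_integers_add:
  assumes "prime p" "x \<in> p_integers p" "y \<in> p_integers p"
  shows "x + y \<in> p_integers p"
proof -
  from assms(2,3) obtain a b c d where 1: "x = of_int a / of_int b" "\<not> int p dvd b"
    "y = of_int c / of_int d" "\<not> int p dvd d" unfolding p_integers_def by blast
  then have nz: "b \<noteq> 0" "d \<noteq> 0" by auto
  have "\<not> int p dvd b * d" using assms(1) 1 by (simp add: prime_dvd_mult_iff)
  moreover have "x + y = of_int (a * d + c * b) / of_int (b * d)"
    using 1 nz by (simp add: field_simps)
  ultimately show ?thesis unfolding p_integers_def by blast
qed

lemma p_integers_minus:
  assumes "x \<in> p_integers p" shows "- x \<in> p_integers p"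
proof -
  from assms obtain a b where 1: "x = of_int a / of_int b" "\<not> int p dvd b"
    unfolding p_integers_def by blast
  then have "- x = of_int (- a) / of_int b" by simp
  with 1 show ?thesis unfolding p_integers_def by blast
qed

lemma p_integers_diff:
  assumes "prime p" "x \<in> p_integers p" "y \<in> p_integers p"
  shows "x - y \<in> p_integers p"
  using p_integers_add[OF assms(1,2) p_integers_minus[OF assms(3)]] by simp

lemma p_integers_first_digit:
  assumes "prime p" "x \<in> p_integers p"
  shows "\<exists>d < p. (x - of_nat d) / of_nat p \<in> p_integers p"
proof -
  from assms obtain a b where 1: "x = of_int a / of_int b" "\<not> int p dvd b"
    unfolding p_integers_def by blast
  have p: "p > 0" using assms(1) by (simp add: prime_gt_0_nat)
  have b: "b \<noteq> 0" using 1 by auto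
  have "coprime (int p) b" using assms(1) 1 by (simp add: prime_imp_coprime)
  then obtain c where c: "[b * c = 1] (mod int p)"
    using cong_solve_coprime_int coprime_commute by metis
  define d where "d = nat ((a * c) mod int p)"
  have d: "d < p" "int d = (a * c) mod int p" unfolding d_def using p by (auto simp: nat_less_iff)
  have "[a - int d * b = a - a * c * b] (mod int p)"
    unfolding d by (intro cong_diff cong_mult) (auto simp: cong_def)
  also have "[a - a * c * b = a - a * 1] (mod int p)"
    using cong_diff[OF cong_refl[of a] cong_mult[OF cong_refl[of a] c]] by (simp add: ac_simps)
  finally have "int p dvd a - int d * b" by (simp add: cong_0_iff)
  then obtain e where e: "a - int d * b = int p * e" by blast
  have "x - of_nat d = of_int (a - int d * b) / of_int b"
    using 1 b by (simp add: field_simps)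
  also have "\<dots> = of_nat p * (of_int e / of_int b)" by (simp add: e)
  finally have "(x - of_nat d) / of_nat p = of_int e / of_int b" using p by simp
  with 1 d(1) show ?thesis unfolding p_integers_def by blast
qed

lemma padic_expansion_exists:
  assumes "prime p" "x \<in> p_integers p"
  shows "\<exists>d. padic_expansion p x d"
proof -
  have p: "p > 0" using assms(1) by (simp add: prime_gt_0_nat)
  define D where "D y = (SOME d. d < p \<and> (y - of_nat d) / of_nat p \<in> p_integers p)" for y :: rat
  have D: "D y < p \<and> (y - of_nat (D y)) / of_nat p \<in> p_integers p" if "y \<in> p_integers p" for y
    unfolding D_def using someI_ex[OF p_integers_first_digit[OF assms(1) that, simplified]] by blast
  define r where "r n = ((\<lambda>y. (y - of_nat (D y)) / of_nat p) ^^ n) x" for n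
  have rSuc: "r (Suc n) = (r n - of_nat (D (r n))) / of_nat p" for n by (simp add: r_def)
  have r: "r n \<in> p_integers p" for n
    by (induction n) (use D rSuc assms(2) in \<open>auto simp: r_def\<close>)
  have "x - (\<Sum>j<n. of_nat (D (r j)) * of_nat p ^ j) = of_nat p ^ n * r n" for n
  proof (induction n)
    case 0 then show ?case by (simp add: r_def)
  next
    case (Suc n)
    then show ?case using p by (simp add: rSuc field_simps)
  qed
  then have "padic_expansion p x (\<lambda>j. D (r j))"
    unfolding padic_expansion_def pcong_def using r D by blast
  then show ?thesis by blast
qed

lemma p_integers_small:
  assumes "prime p" "of_int k = of_nat p * z" "z \<in> p_integers p"
  shows "int p dvd k"
proof -
  from assms obtain a b where 1: "z = of_int a / of_int b" "\<not> int p dvd b"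
    unfolding p_integers_def by blast
  then have "of_int (k * b) = (of_int (int p * a) :: rat)"
    using assms(2) by (auto simp: field_simps)
  then have "k * b = int p * a" unfolding of_int_eq_iff .
  then have "int p dvd k * b" by simp
  with 1 assms(1) show ?thesis by (simp add: prime_dvd_mult_iff)
qed

lemma padic_expansion_unique:
  assumes "prime p" "padic_expansion p x d" "padic_expansion p x e"
  shows "d = e"
proof
  fix n show "d n = e n"
  proof (induction n rule: less_induct)
    case (less n)
    have p: "p > 0" using assms(1) by (simp add: prime_gt_0_nat)
    define s where "s = (\<Sum>j<n. of_nat (d j) * of_nat p ^ j :: rat)"
    have s: "s = (\<Sum>j<n. of_nat (e j) * of_nat p ^ j)"
      unfolding s_def using less by simp
    from assms(2) have "pcong p (Suc n) x (s + of_nat (d n) * of_nat p ^ n)"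
      unfolding padic_expansion_def s_def
      by (metis (no_types, lifting) sum.lessThan_Suc)
    then obtain z where z: "z \<in> p_integers p"
      "x - (s + of_nat (d n) * of_nat p ^ n) = of_nat p ^ Suc n * z" unfolding pcong_def by blast
    from assms(3) have "pcong p (Suc n) x (s + of_nat (e n) * of_nat p ^ n)"
      unfolding padic_expansion_def s
      by (metis (no_types, lifting) sum.lessThan_Suc)
    then obtain w where w: "w \<in> p_integers p"
      "x - (s + of_nat (e n) * of_nat p ^ n) = of_nat p ^ Suc n * w" unfolding pcong_def by blast
    have "of_nat p ^ n * (of_nat (d n) - of_nat (e n)) = of_nat p ^ n * (of_nat p * (w - z))"
      using z(2) w(2) by (simp add: algebra_simps)
    then have "of_int (int (d n) - int (e n)) = of_nat p * (w - z)"
      using p by simp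
    then have "int p dvd int (d n) - int (e n)"
      using p_integers_small assms(1) p_integers_diff w(1) z(1) by blast
    then have "[int (d n) = int (e n)] (mod int p)" by (simp add: cong_iff_dvd_diff)
    moreover have "d n < p" "e n < p" using assms unfolding padic_expansion_def by auto
    ultimately show ?case by (simp add: cong_int_iff cong_less_modulus_unique_nat)
  qed
qed

lemma padic_expansion_padic_digit:
  assumes "prime p" "x \<in> p_integers p"
  shows "padic_expansion p x (padic_digit p x)"
  unfolding padic_digit_def
  using padic_expansion_exists[OF assms] padic_expansion_unique[OF assms(1)] by (metis theI)

lemma odd_harmonic_p_integer:
  assumes "prime p" shows "odd_harmonic p \<in> p_integers p"
proof -
  have fin: "finite {k. odd k \<and> k \<le> p - 2}" by simp
  have "(1 / of_nat k :: rat) \<in> p_integers p" if "odd k" "k \<le> p - 2" for k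
  proof -
    have "k > 0" "k < p" using that assms prime_gt_1_nat[of p] by (auto simp: odd_pos)
    then have "\<not> int p dvd int k" by (auto simp: nat_dvd_not_less)
    moreover have "(1 / of_nat k :: rat) = of_int 1 / of_int (int k)" by simp
    ultimately show ?thesis unfolding p_integers_def by blast
  qed
  moreover have "0 \<in> p_integers p" using p_integers_of_int[OF assms, of 0] by simp
  moreover have sumI: "sum f S \<in> p_integers p"
    if "finite S" "\<And>k. k \<in> S \<Longrightarrow> f k \<in> p_integers p" "0 \<in> p_integers p" for f and S :: "nat set"
    using that by (induction S rule: finite_induct) (auto intro: p_integers_add[OF assms])
  ultimately show ?thesis unfolding odd_harmonic_def using fin by (intro sumI) auto
qed

lemma padic_digit_of_nat_less:
  assumes "prime p" "m < p"
  shows "padic_digit p (of_nat m) j = (if j = 0 then m else 0)"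
proof -
  have "pcong p n (of_nat m) (\<Sum>j<n. of_nat (if j = 0 then m else 0) * of_nat p ^ j)" for n
  proof (cases n)
    case 0
    have "(of_nat m :: rat) \<in> p_integers p" using p_integers_of_int[OF assms(1), of "int m"] by simp
    with 0 show ?thesis by (auto simp: pcong_def)
  next
    case (Suc k)
    have "(\<Sum>j<n. of_nat (if j = 0 then m else 0) * of_nat p ^ j) = (of_nat m :: rat)"
      unfolding Suc sum.lessThan_Suc_shift by simp
    moreover have "0 \<in> p_integers p" using p_integers_of_int[OF assms(1), of 0] by simp
    ultimately show ?thesis by (auto simp: pcong_def)
  qed
  then have e: "padic_expansion p (of_nat m) (\<lambda>j. if j = 0 then m else 0)"
    using assms(2) by (auto simp: padic_expansion_def)
  have "padic_expansion p (of_nat m) (padic_digit p (of_nat m))"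
    using padic_expansion_padic_digit[OF assms(1)] p_integers_of_int[OF assms(1), of "int m"] by simp
  from padic_expansion_unique[OF assms(1) this e] show ?thesis by simp
qed

lemma bernoulli_2: "bernoulli 2 = 1 / 6"
proof -
  have "bernoulli 0 = 1" by (subst bernoulli.simps) simp
  moreover from this have "bernoulli 1 = - 1 / 2" by (subst bernoulli.simps) simp
  ultimately show ?thesis
    by (subst bernoulli.simps) (simp add: numeral_2_eq_2)
qed

lemma num_even_ascents_1: "num_even_ascents 1 = 1"
proof -
  have "{f. f permutes {1..1::nat} \<and> even (card (ascents 1 f))} = {id}"
    by (auto simp: ascents_def permutes_id)
  then show ?thesis by (simp add: num_even_ascents_def)
qed

(* The second congruence fails for p = 3: its left side is 0 and its right side is 7/2. *)
lemma second_congruence_fails_for_3: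
  "\<not> pcong 3 1
     (of_nat (padic_digit 3 (of_nat (2 * num_even_ascents (3 - 2))) 1)
       + of_nat (padic_digit 3 (of_nat (padic_digit 3 (of_nat (2 * num_even_ascents (3 - 2))) 0) - 1) 1))
     (3 / 2 * of_nat (padic_digit 3 (odd_harmonic 3) 0) ^ 2 + of_nat (padic_digit 3 (odd_harmonic 3) 1)
       + of_nat (padic_digit 3 (odd_harmonic 3) 0)
       - agoh_giuga 3 * (1 + of_nat (padic_digit 3 (odd_harmonic 3) 0)) + 2)"
proof -
  have p3: "prime (3 :: nat)" by simp
  have "{k :: nat. odd k \<and> k \<le> 3 - 2} = {1}" by (auto simp: le_Suc_eq)
  then have H: "odd_harmonic 3 = 1" by (simp add: odd_harmonic_def)
  have A: "agoh_giuga 3 = 1 / 2" by (simp add: agoh_giuga_def bernoulli_2)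
  have d1: "padic_digit 3 1 j = (if j = 0 then 1 else 0)" for j
    using padic_digit_of_nat_less[OF p3, of 1] by simp
  have d2: "padic_digit 3 2 j = (if j = 0 then 2 else 0)" for j
    using padic_digit_of_nat_less[OF p3, of 2] by simp
  have "\<not> pcong 3 1 0 (7 / 2)"
  proof
    assume "pcong 3 1 0 (7 / 2)"
    then obtain z where z: "z \<in> p_integers 3" "- 7 / 2 = 3 * z" by (auto simp: pcong_def)
    then have "z + z \<in> p_integers 3" using p_integers_add[OF p3] by blast
    moreover have "of_int (- 7) = of_nat 3 * (z + z)" using z(2) by simp
    ultimately have "int 3 dvd - 7" using p_integers_small[OF p3] by blast
    then show False by simp
  qed
  then show ?thesis
    using num_even_ascents_1 by (simp add: H A d1 d2)
qed

end

theory Submission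
  imports Defs "HOL-Computational_Algebra.Formal_Power_Series" "HOL-Combinatorics.Multiset_Permutations"
begin

text \<open>
  Write $q = (2^{p-1}-1)/p$ and let $E_n(t)$ be the Eulerian polynomial, so that
  $2 N_n = n! + E_n(-1)$. The $n$-th derivative of $1/(1+e^x)$ is
  $-e^x E_n(-e^x)/(1+e^x)^{n+1}$; at $x = 0$ this yields
  $(n+1) E_n(-1) = 2^{n+1}(2^{n+1}-1) B_{n+1}$, which for $n = p-2$ equals
  $(1+pq)\,q\,(pA-1)$. Faulhaber's formula and Wilson's theorem give
  $(p-1)! \equiv pA - 1 - p$ modulo $p^2$, and two factorisations of $(p-1)!$
  give $H'_{p-1} \equiv q - pq^2/2$ modulo $p^2$. Eliminating $q$,
  \[ 2N_{p-2} \equiv 1 + H' + p\,\bigl(\tfrac32 H'^2 + H' + 2 - A(1+H')\bigr) \pmod{p^2}. \]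
  Reading this off in base $p$, the term $((2N_{p-2})_0-1)_1$ is the carry: it is $p-1$
  if $(H')_0 = p-1$ and $0$ otherwise.
\<close>

text \<open>The obstacle is the \<open>p\<close> in the denominator of
  \<open>bernoulli (p - 1)\<close>. It is absorbed by the factor
  \<open>2 ^ (p - 1) - 1 = p * q\<close>, so that only
  \<open>p * bernoulli (p - 1) = p * A - 1\<close> enters. Consequently \<open>A\<close> is needed
  only modulo \<open>p\<close>, whereas \<open>H'\<close> is needed modulo \<open>p^2\<close>, since
  it also occurs without a factor \<open>p\<close>. The coefficient 3/2 is 1 + 1/2: one
  \<open>q^2\<close> comes from the factor \<open>2 ^ (p - 1) = 1 + p * q\<close> of the Eulerian
  value, and the half from inverting \<open>H' = q - p * q^2 / 2\<close> to
  \<open>q = H' + p * H'^2 / 2\<close>. The prime 3 is exceptional because the sum of the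
  \<open>1 / j^2\<close> over \<open>j < p/2\<close> is shown to vanish modulo \<open>p\<close> by
  cancelling a 3; for \<open>p = 3\<close> that sum is 1. Congruences are opened into equations with
  an explicit p-integral error term. Cancelling a factor \<open>p\<close> is then exact, and each
  elimination is a polynomial identity.\<close>

unbundle fps_syntax

subsection \<open>Ascents and Eulerian polynomials\<close>

text \<open>Permutations are treated as words because the Eulerian recurrence inserts a new largest
  letter.\<close>

fun asc :: "nat list \<Rightarrow> nat" where
  "asc (x # y # xs) = (if x < y then 1 else 0) + asc (y # xs)"
| "asc _ = 0"

definition insert_at :: "nat \<Rightarrow> 'a \<Rightarrow> 'a list \<Rightarrow> 'a list" where
  "insert_at i m xs = take i xs @ m # drop i xs"

lemma insert_at_0 [simp]: "insert_at 0 m xs = m # xs"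
  by (simp add: insert_at_def)

lemma insert_at_Nil [simp]: "insert_at i m [] = [m]"
  by (simp add: insert_at_def)

lemma insert_at_Suc [simp]: "insert_at (Suc i) m (x # xs) = x # insert_at i m xs"
  by (simp add: insert_at_def)

text \<open>The start \<open>a\<close> is arbitrary because the induction peels off the first index,
  leaving a word that starts at \<open>Suc a\<close>.\<close>

lemma asc_map_upt: "asc (map f [a..<a + Suc n]) = card {k \<in> {a..<a + n}. f (Suc k) > f k}"
proof (induction n arbitrary: a)
  case 0
  then show ?case by simp
next
  case (Suc n)
  have "{k \<in> {a..<a + Suc n}. f (Suc k) > f k} =
    (if f a < f (Suc a) then {a} else {}) \<union> {k \<in> {Suc a..<Suc a + n}. f (Suc k) > f k}"
    by (auto simp: le_less Suc_le_eq)
  moreover have "card \<dots> = (if f a < f (Suc a) then 1 else 0)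
      + card {k \<in> {Suc a..<Suc a + n}. f (Suc k) > f k}"
    by (subst card_Un_disjoint) auto
  moreover have "[a..<a + Suc (Suc n)] = a # Suc a # [Suc (Suc a)..<a + Suc (Suc n)]"
    by (simp add: upt_rec del: upt_Suc)
  moreover have "[Suc a..<Suc a + Suc n] = Suc a # [Suc (Suc a)..<a + Suc (Suc n)]"
    by (simp add: upt_rec del: upt_Suc)
  ultimately show ?case using Suc[of "Suc a"] by (simp del: upt_Suc)
qed

lemma asc_map_ascents: "asc (map f [1..<Suc n]) = card (ascents n f)"
proof (cases n)
  case (Suc k)
  then show ?thesis using asc_map_upt[of f 1 k] by (simp add: ascents_def del: upt_Suc)
qed (simp add: ascents_def)

lemma bij_betw_permutes_permutations:
  "bij_betw (\<lambda>f. map f [1..<Suc n]) {f. f permutes {1..n}} (permutations_of_set {1..n})"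
proof -
  let ?F = "\<lambda>f. map f [1..<Suc n]"
  have s: "set [1..<Suc n] = {1..n}" by auto
  have inj: "inj_on ?F {f. f permutes {1..n}}"
  proof (rule inj_onI)
    fix f g
    assume *: "f \<in> {f. f permutes {1..n}}" "g \<in> {f. f permutes {1..n}}" "?F f = ?F g"
    have "f x = g x" for x
    proof (cases "x \<in> {1..n}")
      case True
      with *(3) s show ?thesis by (metis map_eq_conv)
    next
      case False
      with * show ?thesis by (metis mem_Collect_eq permutes_not_in)
    qed
    then show "f = g" by blast
  qed
  have sub: "?F ` {f. f permutes {1..n}} \<subseteq> permutations_of_set {1..n}"
  proof clarify
    fix f assume f: "f permutes {1..n}"
    then show "?F f \<in> permutations_of_set {1..n}"
      using permutes_image[OF f] s
      by (intro permutations_of_setI)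
        (auto simp: distinct_map permutes_inj_on simp del: upt_Suc)
  qed
  have "card (?F ` {f. f permutes {1..n}}) = card (permutations_of_set {1..n})"
    using card_image[OF inj] card_permutations[of "{1..n}" n] by simp
  with sub have "?F ` {f. f permutes {1..n}} = permutations_of_set {1..n}"
    by (intro card_subset_eq) auto
  with inj show ?thesis by (simp add: bij_betw_def)
qed

text \<open>The letter \<open>m\<close> occurs in neither part of the word, so it marks the cut and
  makes the insertion injective. Surjectivity is a count: \<open>card S + 1\<close> positions times
  \<open>card S\<close> factorial words.\<close>

lemma bij_betw_insert_at:
  assumes "finite S" "m \<notin> S"
  shows "bij_betw (\<lambda>(xs, i). insert_at i m xs) (permutations_of_set S \<times> {..card S})
    (permutations_of_set (insert m S))"
proof -
  let ?F = "\<lambda>(xs, i). insert_at i m xs"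
  let ?D = "permutations_of_set S \<times> {..card S}"
  have inj: "inj_on ?F ?D"
  proof (rule inj_onI)
    fix u v assume u: "u \<in> ?D" and v: "v \<in> ?D" and eq: "?F u = ?F v"
    obtain xs i ys j where uv: "u = (xs, i)" "v = (ys, j)" by (cases u, cases v) auto
    have *: "m \<notin> set xs" "m \<notin> set ys" "length xs = card S" "length ys = card S"
        "i \<le> card S" "j \<le> card S"
      using u v assms unfolding uv
      by (auto simp: permutations_of_setD length_finite_permutations_of_set)
    have e: "take i xs @ m # drop i xs = take j ys @ m # drop j ys"
      using eq by (simp add: uv insert_at_def)
    moreover have "m \<notin> set (take i xs)" "m \<notin> set (take j ys)"
      using * by (auto dest: in_set_takeD)
    moreover have "m \<notin> set (drop i xs)" "m \<notin> set (drop j ys)"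
      using * by (auto dest: in_set_dropD)
    ultimately have t: "take i xs = take j ys" "drop i xs = drop j ys"
      by (auto simp: append_Cons_eq_iff)
    then have "xs = ys" by (metis append_take_drop_id)
    moreover have "i = j" using arg_cong[OF t(1), of length] * by simp
    ultimately show "u = v" by (simp add: uv)
  qed
  have sub: "?F ` ?D \<subseteq> permutations_of_set (insert m S)"
  proof clarify
    fix xs i assume "xs \<in> permutations_of_set S"
    then have xs: "set xs = S" "distinct xs" by (auto dest: permutations_of_setD)
    have "set (take i xs) \<union> set (drop i xs) = S"
      using xs by (metis append_take_drop_id set_append)
    then have "set (insert_at i m xs) = insert m S"
      by (auto simp: insert_at_def)
    moreover have "distinct (insert_at i m xs)"
      using xs assms(2) by (auto simp: insert_at_def dest: in_set_takeD in_set_dropD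
        set_take_disj_set_drop_if_distinct[of xs i i, THEN equalityD1, THEN subsetD])
    ultimately show "insert_at i m xs \<in> permutations_of_set (insert m S)"
      by (intro permutations_of_setI)
  qed
  have "card (?F ` ?D) = card (permutations_of_set (insert m S))"
    using card_image[OF inj] assms by simp
  with sub have "?F ` ?D = permutations_of_set (insert m S)"
    by (intro card_subset_eq) (auto simp: assms)
  with inj show ?thesis by (simp add: bij_betw_def)
qed

text \<open>A new maximum keeps the number of ascents if it goes to the front or into an ascent, and
  raises it by one if it goes into a descent or to the end. The weight \<phi> is arbitrary because
  the induction shifts it by the contribution of the first pair.\<close>

lemma sum_asc_insert_at:
  fixes \<phi> :: "nat \<Rightarrow> 'a :: comm_ring_1"
  assumes "\<And>x. x \<in> set xs \<Longrightarrow> x < m"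
  shows "(\<Sum>i\<le>length xs. \<phi> (asc (insert_at i m xs))) =
    of_nat (Suc (asc xs)) * \<phi> (asc xs) + (of_nat (length xs) - of_nat (asc xs)) * \<phi> (Suc (asc xs))"
  using assms
proof (induction xs arbitrary: \<phi>)
  case Nil
  then show ?case by simp
next
  case (Cons x xs)
  show ?case
  proof (cases xs)
    case Nil
    with Cons.prems show ?thesis by simp
  next
    case xs: (Cons y ys)
    define c :: nat where "c = (if x < y then 1 else 0)"
    define a where "a = asc xs"
    have IH: "(\<Sum>i\<le>length xs. \<phi> (c + asc (insert_at i m xs))) =
      of_nat (Suc a) * \<phi> (c + a) + (of_nat (length xs) - of_nat a) * \<phi> (c + Suc a)"
      unfolding a_def using Cons.IH[of "\<lambda>k. \<phi> (c + k)"] Cons.prems by simp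
    have my: "\<not> m < y" "\<not> m < x" "x < m" "y < m" using Cons.prems[of y] Cons.prems[of x] xs by auto
    have Suc: "asc (insert_at (Suc (Suc i)) m (x # xs)) = c + asc (insert_at (Suc i) m xs)" for i
      by (simp add: xs c_def)
    have 0: "asc (insert_at 0 m xs) = a" using my by (simp add: xs a_def)
    have len: "length xs = Suc (length ys)" by (simp add: xs)
    \<comment> \<open>Positions 0 and 1 are separated: in front of \<open>x\<close> the pair
      \<open>x, y\<close> stays intact and gives \<open>c + a\<close>; between \<open>x\<close> and
      \<open>y\<close> the comparison is replaced by one ascent and one descent, which gives
      \<open>Suc a\<close>.\<close>
    have "(\<Sum>i\<le>length (x # xs). \<phi> (asc (insert_at i m (x # xs)))) =
      \<phi> (c + a) + \<phi> (Suc a) + (\<Sum>i\<le>length ys. \<phi> (c + asc (insert_at (Suc i) m xs)))"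
      unfolding length_Cons len sum.atMost_Suc_shift Suc
      using my by (simp add: xs a_def c_def)
    also have "(\<Sum>i\<le>length ys. \<phi> (c + asc (insert_at (Suc i) m xs))) =
      (\<Sum>i\<le>length xs. \<phi> (c + asc (insert_at i m xs))) - \<phi> (c + a)"
      unfolding len sum.atMost_Suc_shift 0 by simp
    finally have *: "(\<Sum>i\<le>length (x # xs). \<phi> (asc (insert_at i m (x # xs)))) = \<phi> (Suc a) +
      (of_nat (Suc a) * \<phi> (c + a) + (of_nat (length xs) - of_nat a) * \<phi> (c + Suc a))"
      unfolding IH by simp
    moreover have "asc (x # xs) = c + a" by (simp add: xs c_def a_def)
    ultimately show ?thesis by (cases "x < y") (simp_all add: c_def algebra_simps)
  qed
qed

text \<open>Any commutative ring is allowed, since the argument will be the integer -1, the rational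
  -1 and the power series \<open>- E\<close>.\<close>

definition eulerian_poly :: "nat \<Rightarrow> 'a :: comm_ring_1 \<Rightarrow> 'a" where
  "eulerian_poly n t = (\<Sum>xs\<in>permutations_of_set {1..n}. t ^ asc xs)"

text \<open>This is the recurrence \<open>E_(n+1) = (1 + n t) E_n + t (1 - t) E_n'\<close>, with the
  derivative left as a weighted sum over words so that \<open>t\<close> may lie in any ring.\<close>

lemma eulerian_poly_Suc:
  "eulerian_poly (Suc n) t = (\<Sum>xs\<in>permutations_of_set {1..n}.
     of_nat (Suc (asc xs)) * t ^ asc xs + (of_nat n - of_nat (asc xs)) * t ^ Suc (asc xs))"
proof -
  have "eulerian_poly (Suc n) t = (\<Sum>xs\<in>permutations_of_set (insert (Suc n) {1..n}). t ^ asc xs)"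
    by (simp add: eulerian_poly_def atLeastAtMostSuc_conv)
  also have "\<dots> = (\<Sum>(xs, i)\<in>permutations_of_set {1..n} \<times> {..n}. t ^ asc (insert_at i (Suc n) xs))"
    using sum.reindex_bij_betw[OF bij_betw_insert_at[of "{1..n}" "Suc n"], of "\<lambda>xs. t ^ asc xs"]
    by (simp add: case_prod_unfold)
  also have "\<dots> = (\<Sum>xs\<in>permutations_of_set {1..n}. \<Sum>i\<le>n. t ^ asc (insert_at i (Suc n) xs))"
    by (simp add: sum.cartesian_product)
  also have "\<dots> = (\<Sum>xs\<in>permutations_of_set {1..n}.
     of_nat (Suc (asc xs)) * t ^ asc xs + (of_nat n - of_nat (asc xs)) * t ^ Suc (asc xs))"
  proof (rule sum.cong[OF refl])
    fix xs assume xs: "xs \<in> permutations_of_set {1..n}"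
    then have l: "length xs = n" using length_finite_permutations_of_set[of xs "{1..n}"] by simp
    show "(\<Sum>i\<le>n. t ^ asc (insert_at i (Suc n) xs)) =
      of_nat (Suc (asc xs)) * t ^ asc xs + (of_nat n - of_nat (asc xs)) * t ^ Suc (asc xs)"
      using sum_asc_insert_at[of xs "Suc n" "\<lambda>k. t ^ k"] permutations_of_setD(1)[OF xs] l by auto
  qed
  finally show ?thesis .
qed

lemma eulerian_poly_1 [simp]: "eulerian_poly (Suc 0) t = 1"
  by (simp add: eulerian_poly_def)

text \<open>Each word contributes \<open>1 + (- 1) ^ asc xs\<close>, which is 2 or 0.\<close>

lemma num_even_ascents_eulerian:
  "2 * int (num_even_ascents n) = fact n + eulerian_poly n (- 1)"
proof -
  let ?P = "permutations_of_set {1..n}"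
  have "bij_betw (\<lambda>f. map f [1..<Suc n]) {f. f permutes {1..n} \<and> even (card (ascents n f))}
      {xs \<in> ?P. even (asc xs)}"
    using bij_betw_Collect[OF bij_betw_permutes_permutations[of n], of "\<lambda>xs. even (asc xs)"
      "\<lambda>f. even (card (ascents n f))"] by (simp only: asc_map_ascents mem_Collect_eq)
  then have "num_even_ascents n = card {xs \<in> ?P. even (asc xs)}"
    unfolding num_even_ascents_def by (rule bij_betw_same_card)
  also have "int \<dots> = (\<Sum>xs\<in>?P. if even (asc xs) then 1 else 0)"
    by (simp add: sum.If_cases flip: Collect_conj_eq) (simp add: Int_def)
  finally have "2 * int (num_even_ascents n) = (\<Sum>xs\<in>?P. 1 + (- 1) ^ asc xs)"
    by (simp add: sum_distrib_left) (intro sum.cong, auto)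
  then show ?thesis by (simp add: sum.distrib eulerian_poly_def)
qed

lemma eulerian_poly_of_int: "eulerian_poly n (of_int t) = of_int (eulerian_poly n t)"
  by (simp add: eulerian_poly_def)

subsection \<open>Bernoulli numbers\<close>

text \<open>Since \<open>E' = E\<close>, differentiation sends \<open>(- E) ^ k\<close> to
  \<open>k * (- E) ^ k\<close>, so it acts on polynomials in \<open>t = - E\<close> as
  \<open>t d/dt\<close>. With \<open>R * (1 + E) = 1\<close> bringing all terms over the same power
  of \<open>R\<close>, the induction step becomes the Eulerian recurrence.\<close>

lemma nth_deriv_inverse_exp_plus_1:
  fixes E R :: "rat fps"
  defines "E \<equiv> fps_exp 1" and "R \<equiv> inverse (1 + E)"
  shows "fps_nth_deriv (Suc n) R = - E * eulerian_poly (Suc n) (- E) * R ^ (n + 2)"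
proof (induction n)
  have E: "fps_deriv E = E" by (simp add: E_def)
  have "(1 + E) $ 0 \<noteq> 0" by (simp add: E_def)
  then have RE: "R * (1 + E) = 1" unfolding R_def by (rule inverse_mult_eq_1)
  have dR: "fps_deriv R = - E * R ^ 2"
    unfolding R_def using fps_inverse_deriv[OF \<open>(1 + E) $ 0 \<noteq> 0\<close>] by (simp add: E)
  {
    case 0
    show ?case using dR by (simp add: power2_eq_square)
  next
    case (Suc n)
    let ?P = "permutations_of_set {1..Suc n}"
    have dpow: "fps_deriv ((- E) ^ k) = of_nat k * (- E) ^ k" for k
      by (induction k) (simp_all add: E algebra_simps)
    have dS: "fps_deriv (eulerian_poly (Suc n) (- E)) = (\<Sum>xs\<in>?P. of_nat (asc xs) * (- E) ^ asc xs)"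
      unfolding eulerian_poly_def fps_deriv_sum dpow ..
    have dRn: "fps_deriv (R ^ k) = - of_nat k * E * R ^ Suc k" for k
      by (induction k) (simp_all add: dR algebra_simps power2_eq_square)
    have "fps_nth_deriv (Suc (Suc n)) R = fps_deriv (- E * eulerian_poly (Suc n) (- E) * R ^ (n + 2))"
      unfolding fps_nth_deriv_commute[of "Suc n"] Suc ..
    also have "\<dots> = - E * ((eulerian_poly (Suc n) (- E) + fps_deriv (eulerian_poly (Suc n) (- E))) * (1 + E)
        - of_nat (n + 2) * E * eulerian_poly (Suc n) (- E)) * R ^ (n + 3)"
    proof -
      \<comment> \<open>Here \<open>x\<close> stands for \<open>R ^ (n + 2)\<close> and
        \<open>y\<close> for \<open>R ^ (n + 3)\<close>; keeping them abstract makes the claim a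
        polynomial identity.\<close>
      have rearrange: "fps_deriv (- E * S * x) = - E * ((S + fps_deriv S) * (1 + E) - c * E * S) * y"
        if "fps_deriv x = - c * E * y" "x = y * (1 + E)" for S x y c :: "rat fps"
        unfolding fps_deriv_mult fps_deriv_neg that(1) E unfolding that(2) by (simp add: algebra_simps)
      show ?thesis
      proof (rule rearrange)
        show "fps_deriv (R ^ (n + 2)) = - of_nat (n + 2) * E * R ^ (n + 3)"
          unfolding dRn by (simp add: numeral_3_eq_3)
        show "R ^ (n + 2) = R ^ (n + 3) * (1 + E)"
        proof -
          have "R ^ (n + 3) = R ^ (n + 2) * R" using power_Suc2[of R "n + 2"] by (simp add: numeral_3_eq_3)
          then show ?thesis by (simp only: mult.assoc RE mult_1_right)
        qed
      qed
    qed
    also have "(eulerian_poly (Suc n) (- E) + fps_deriv (eulerian_poly (Suc n) (- E))) * (1 + E)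
        - of_nat (n + 2) * E * eulerian_poly (Suc n) (- E) = eulerian_poly (Suc (Suc n)) (- E)"
      unfolding eulerian_poly_Suc[of "Suc n"] dS unfolding eulerian_poly_def
      unfolding sum_distrib_left sum_distrib_right sum.distrib[symmetric] sum_subtractf[symmetric]
      by (intro sum.cong) (auto simp: algebra_simps)
    finally show ?case by (simp add: numeral_3_eq_3)
  }
qed

text \<open>The series of \<open>c x / (e^(c x) - 1)\<close>; the scales 1 and 2 are both
  used.\<close>

definition bernoulli_gf :: "rat \<Rightarrow> rat fps" where
  "bernoulli_gf c = Abs_fps (\<lambda>n. c ^ n * bernoulli n / fact n)"

lemma sum_choose_bernoulli:
  "(\<Sum>k\<le>n. of_nat (Suc n choose k) * bernoulli k) = (if n = 0 then 1 else 0)"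
proof (cases "n = 0")
  case True
  then show ?thesis by (simp add: bernoulli.simps[of 0])
next
  case False
  have "bernoulli n * of_nat (Suc n) = - (\<Sum>k<n. of_nat (Suc n choose k) * bernoulli k)"
    using False by (subst bernoulli.simps) (simp add: field_simps del: of_nat_Suc)
  then show ?thesis using False
    by (simp add: lessThan_Suc_atMost[symmetric] algebra_simps del: of_nat_Suc)
qed

text \<open>The coefficients express the Bernoulli recurrence multiplied by
  \<open>c ^ n / fact n\<close>. The product form is used because \<open>fps_exp c - 1\<close> has
  constant term 0 and hence no inverse.\<close>

lemma bernoulli_gf_mult: "bernoulli_gf c * (fps_exp c - 1) = fps_const c * fps_X"
proof (rule fps_ext)
  fix n
  show "(bernoulli_gf c * (fps_exp c - 1)) $ n = (fps_const c * fps_X) $ n"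
  proof (cases n)
    case 0
    then show ?thesis by simp
  next
    case (Suc m)
    have rearrange: "x * b / f * (y / g) = cn / fn * (ch * b)"
      if "x * y = cn" "ch = fn / (f * g)" "fn \<noteq> 0" for x y b f g cn fn ch :: rat
      unfolding that(2) that(1)[symmetric] using that(3) by simp
    have "(bernoulli_gf c * (fps_exp c - 1)) $ n =
      (\<Sum>k\<le>m. c ^ k * bernoulli k / fact k * (c ^ (n - k) / fact (n - k)))"
      unfolding fps_mult_nth Suc atLeast0AtMost sum.atMost_Suc
      by (simp add: bernoulli_gf_def)
    also have "\<dots> = (\<Sum>k\<le>m. c ^ n / fact n * (of_nat (Suc m choose k) * bernoulli k))"
    proof (intro sum.cong refl)
      fix k assume "k \<in> {..m}"
      then have "k \<le> n" using Suc by simp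
      then have "c ^ k * c ^ (n - k) = c ^ n" by (metis le_add_diff_inverse power_add)
      moreover have "of_nat (n choose k) = (fact n / (fact k * fact (n - k)) :: rat)"
        using \<open>k \<le> n\<close> by (simp add: binomial_fact)
      ultimately show "c ^ k * bernoulli k / fact k * (c ^ (n - k) / fact (n - k)) =
          c ^ n / fact n * (of_nat (Suc m choose k) * bernoulli k)"
        unfolding Suc[symmetric] by (intro rearrange) auto
    qed
    also have "\<dots> = (fps_const c * fps_X) $ n"
      unfolding sum_distrib_left[symmetric] sum_choose_bernoulli using Suc by simp
    finally show ?thesis .
  qed
qed

text \<open>The partial fractions \<open>x / (e^x + 1) = x / (e^x - 1) - 2 x / (e^(2 x) - 1)\<close>
  give the coefficients of \<open>1 / (1 + e^x)\<close> in Bernoulli numbers; the derivative formula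
  gives them in Eulerian values. For \<open>n = 0\<close> the two sides would be 1 and -1.\<close>

lemma eulerian_poly_minus_1:
  assumes "n > 0"
  shows "of_nat (Suc n) * eulerian_poly n (- 1) = 2 ^ Suc n * (2 ^ Suc n - 1) * bernoulli (Suc n)"
proof -
  define E :: "rat fps" where "E = fps_exp 1"
  define R where "R = inverse (1 + E)"
  have E0: "E $ 0 = 1" by (simp add: E_def)
  have RE: "R * (1 + E) = 1" unfolding R_def by (rule inverse_mult_eq_1) (simp add: E0)
  have E2: "fps_exp 2 = E * E" using fps_exp_add_mult[of "1::rat" 1] by (simp add: E_def)
  have "(E - 1) $ 1 \<noteq> 0" by (simp add: E_def)
  then have Enz: "E - 1 \<noteq> 0" by force
  have 1: "bernoulli_gf 1 * (E - 1) = fps_X" using bernoulli_gf_mult[of 1] by (simp add: E_def)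
  have 2: "bernoulli_gf 2 * (E * E - 1) = 2 * fps_X" using bernoulli_gf_mult[of 2] 
    by (simp add: E2 numeral_fps_const)
  have "(bernoulli_gf 1 - bernoulli_gf 2) * (1 + E) * (E - 1) =
      bernoulli_gf 1 * (E - 1) * (1 + E) - bernoulli_gf 2 * (E * E - 1)" by (simp add: algebra_simps)
  also have "\<dots> = fps_X * (E - 1)" unfolding 1 2 by (simp add: algebra_simps)
  finally have "(bernoulli_gf 1 - bernoulli_gf 2) * (1 + E) = fps_X" using Enz by simp
  then have XR: "fps_X * R = bernoulli_gf 1 - bernoulli_gf 2"
    using RE by (metis mult.assoc mult.commute mult.right_neutral)
  have R: "R $ n = (1 - 2 ^ Suc n) * bernoulli (Suc n) / fact (Suc n)"
    using arg_cong[OF XR, of "\<lambda>f. f $ Suc n"]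
    by (simp add: bernoulli_gf_def algebra_simps diff_divide_distrib del: fact_Suc)
  obtain m where m: "n = Suc m" using assms by (cases n) auto
  have e0: "eulerian_poly n f $ 0 = eulerian_poly n (f $ 0)" for f :: "rat fps"
    by (simp add: eulerian_poly_def fps_sum_nth fps_nth_power_0)
  have "fact n * R $ n = fps_nth_deriv n R $ 0" by (simp add: fps_deriv_maclauren_0)
  also have "\<dots> = - eulerian_poly n (- 1) / 2 ^ Suc n"
    unfolding m R_def E_def nth_deriv_inverse_exp_plus_1
    by (simp add: e0[unfolded m] fps_nth_power_0 field_simps)
  finally have "fact n * ((1 - 2 ^ Suc n) * bernoulli (Suc n) / fact (Suc n)) =
    - eulerian_poly n (- 1) / 2 ^ Suc n" unfolding R .
  then have "fact n * (of_nat (Suc n) * eulerian_poly n (- 1)) =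
      fact n * (2 ^ Suc n * (2 ^ Suc n - 1) * bernoulli (Suc n))"
    by (simp add: field_simps del: of_nat_Suc power_Suc)
  then show ?thesis by simp
qed

subsection \<open>Rationals with denominator prime to $p$\<close>

text \<open>The geometric sum of the \<open>e^(a x)\<close> times \<open>e^x - 1\<close> is
  \<open>e^(N x) - 1\<close>. Multiplying by the Bernoulli series replaces \<open>e^x - 1\<close> by
  \<open>x\<close>, and the coefficient of \<open>x^(n+1)\<close> is compared.\<close>

lemma faulhaber:
  "of_nat (Suc n) * (\<Sum>a<N. of_nat a ^ n) =
    (\<Sum>k\<le>n. of_nat (Suc n choose k) * bernoulli k * of_nat N ^ (Suc n - k))"
proof -
  let ?B = "bernoulli_gf 1"
  have "(\<Sum>a<N. fps_exp (of_nat a :: rat)) * (fps_exp 1 - 1) = fps_exp (of_nat N) - 1"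
  proof (induction N)
    case (Suc N)
    have "fps_exp (1 + of_nat N) = fps_exp 1 * fps_exp (of_nat N :: rat)"
      by (rule fps_exp_add_mult)
    with Suc show ?case by (simp add: algebra_simps)
  qed simp
  then have "(\<Sum>a<N. fps_exp (of_nat a :: rat)) * (?B * (fps_exp 1 - 1)) = ?B * (fps_exp (of_nat N) - 1)"
    by (metis mult.left_commute)
  then have eq: "(\<Sum>a<N. fps_exp (of_nat a :: rat)) * fps_X = ?B * (fps_exp (of_nat N) - 1)"
    unfolding bernoulli_gf_mult by simp
  have "(\<Sum>a<N. of_nat a ^ n) / fact n = ((\<Sum>a<N. fps_exp (of_nat a :: rat)) * fps_X) $ Suc n"
    by (simp add: fps_sum_nth sum_divide_distrib)
  also have "\<dots> = (\<Sum>k\<le>n. bernoulli k / fact k * (of_nat N ^ (Suc n - k) / fact (Suc n - k)))"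
    unfolding eq fps_mult_nth atLeast0AtMost sum.atMost_Suc by (simp add: bernoulli_gf_def)
  also have "\<dots> = (\<Sum>k\<le>n. (of_nat (Suc n choose k) * bernoulli k * of_nat N ^ (Suc n - k)) / fact (Suc n))"
  proof (intro sum.cong refl)
    fix k assume "k \<in> {..n}"
    then have "of_nat (Suc n choose k) = (fact (Suc n) / (fact k * fact (Suc n - k)) :: rat)"
      by (intro binomial_fact) simp
    then show "bernoulli k / fact k * (of_nat N ^ (Suc n - k) / fact (Suc n - k)) =
      (of_nat (Suc n choose k) * bernoulli k * of_nat N ^ (Suc n - k)) / fact (Suc n)"
      by (simp del: fact_Suc)
  qed
  finally show ?thesis
    by (simp add: sum_divide_distrib[symmetric] field_simps del: of_nat_Suc)
qed

context
  fixes p :: nat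
  assumes prime: "prime p"
begin

lemma p_integers_of_nat: "of_nat n \<in> p_integers p"
  using p_integers_of_int[OF prime, of "int n"] by simp

lemma p_integers_numeral: "numeral n \<in> p_integers p"
  using p_integers_of_nat[of "numeral n"] by simp

lemma p_integers_0: "0 \<in> p_integers p"
  using p_integers_of_nat[of 0] by simp

lemma p_integers_1: "1 \<in> p_integers p"
  using p_integers_of_nat[of 1] by simp

lemma p_integers_mult:
  assumes "x \<in> p_integers p" "y \<in> p_integers p"
  shows "x * y \<in> p_integers p"
proof -
  from assms obtain a b c d where 1: "x = of_int a / of_int b" "\<not> int p dvd b"
    "y = of_int c / of_int d" "\<not> int p dvd d" unfolding p_integers_def by blast
  have "\<not> int p dvd b * d" using prime 1 by (simp add: prime_dvd_mult_iff)
  moreover have "x * y = of_int (a * c) / of_int (b * d)" using 1 by simp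
  ultimately show ?thesis unfolding p_integers_def by blast
qed

lemma p_integers_power: "x \<in> p_integers p \<Longrightarrow> x ^ n \<in> p_integers p"
  by (induction n) (auto intro: p_integers_mult p_integers_1)

lemma p_integers_sum: "(\<And>k. k \<in> S \<Longrightarrow> f k \<in> p_integers p) \<Longrightarrow> sum f S \<in> p_integers p"
  by (induction S rule: infinite_finite_induct) (auto intro: p_integers_add[OF prime] p_integers_0)

lemma p_integers_inverse_of_int:
  assumes "\<not> int p dvd a" shows "1 / of_int a \<in> p_integers p"
  unfolding p_integers_def using assms by (intro CollectI exI[of _ 1] exI[of _ a]) simp

lemma p_integers_inverse_of_nat:
  assumes "\<not> p dvd a" shows "1 / of_nat a \<in> p_integers p"
  using p_integers_inverse_of_int[of "int a"] assms by simp

lemma p_integers_divide_of_nat: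
  assumes "x \<in> p_integers p" "\<not> p dvd a" shows "x / of_nat a \<in> p_integers p"
  using p_integers_mult[OF assms(1) p_integers_inverse_of_nat[OF assms(2)]] by simp

lemmas p_integers_intros = p_integers_of_int[OF prime] p_integers_of_nat p_integers_numeral
  p_integers_0 p_integers_1 p_integers_add[OF prime] p_integers_minus
  p_integers_diff[OF prime] p_integers_mult p_integers_power p_integers_sum

text \<open>The recurrence divides only by \<open>k + 1\<close>, which is below \<open>p\<close> in
  this range; at \<open>k = p - 1\<close> the divisor would be \<open>p\<close> itself.\<close>

lemma bernoulli_p_integer: "k < p - 1 \<Longrightarrow> bernoulli k \<in> p_integers p"
proof (induction k rule: less_induct)
  case (less k)
  have "\<not> p dvd Suc k" using less.prems by (auto dest: dvd_imp_le)
  then have "- (\<Sum>i<k. of_nat (Suc k choose i) * bernoulli i) / of_nat (Suc k) \<in> p_integers p"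
    using less by (intro p_integers_divide_of_nat p_integers_intros) auto
  then show ?case by (subst bernoulli.simps) (simp add: p_integers_1)
qed

section \<open>Congruence of rationals modulo powers of p\<close>

lemma pcongI: "z \<in> p_integers p \<Longrightarrow> x = y + of_nat p ^ n * z \<Longrightarrow> pcong p n x y"
  by (auto simp: pcong_def)

lemma pcongE:
  assumes "pcong p n x y"
  obtains z where "z \<in> p_integers p" "x = y + of_nat p ^ n * z"
  using assms by (force simp: pcong_def algebra_simps)

lemma pcong_of_int:
  assumes "[a = b] (mod int p ^ n)" shows "pcong p n (of_int a) (of_int b)"
proof -
  from assms have "int p ^ n dvd a - b" by (simp add: cong_iff_dvd_diff)
  then obtain k where "a - b = int p ^ n * k" by blast
  then have "a = b + int p ^ n * k" by simp
  then show ?thesis by (intro pcongI[of "of_int k"]) (auto intro: p_integers_intros)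
qed

lemma pcong_trans:
  assumes "pcong p n x y" "pcong p n y z" shows "pcong p n x z"
proof -
  obtain u v where "u \<in> p_integers p" "x = y + of_nat p ^ n * u"
    "v \<in> p_integers p" "y = z + of_nat p ^ n * v" using assms by (elim pcongE) blast
  then show ?thesis by (intro pcongI[of "u + v"]) (auto intro: p_integers_intros simp: algebra_simps)
qed

lemma pcong_sym:
  assumes "pcong p n x y" shows "pcong p n y x"
proof -
  obtain u where "u \<in> p_integers p" "x = y + of_nat p ^ n * u" using assms by (elim pcongE)
  then show ?thesis by (intro pcongI[of "- u"]) (auto intro: p_integers_intros)
qed

text \<open>In Faulhaber's formula divided by \<open>p\<close>, the terms with
  \<open>k \<le> p - 3\<close> carry \<open>p^2\<close> explicitly. The term
  \<open>k = p - 2\<close> carries only \<open>p\<close>, and the second factor comes from the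
  binomial coefficient, where \<open>p \<ge> 3\<close> ensures \<open>k > 0\<close>. The term
  \<open>k = p - 1\<close> is the one that remains.\<close>

lemma sum_power_bernoulli:
  assumes "odd p"
  shows "pcong p 2 (\<Sum>a<p. of_nat a ^ (p - 1)) (of_nat p * bernoulli (p - 1))"
proof -
  have p: "p \<ge> 3" using assms prime prime_ge_2_nat[of p] by (cases "p = 2") auto
  define m where "m = p - 1"
  have pm: "p = Suc m" using p by (simp add: m_def)
  have p0: "(of_nat p :: rat) \<noteq> 0" using p by simp
  define t :: "nat \<Rightarrow> rat" where "t k = of_nat (p choose k) * bernoulli k * of_nat p ^ (m - k)" for k
  have "of_nat p * (\<Sum>a<p. of_nat a ^ m) = (\<Sum>k\<le>m. of_nat p * t k)"
    using faulhaber[of m p] unfolding pm[symmetric]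
    by (subst (asm) sum.cong[OF refl, of _ _ "\<lambda>k. of_nat p * t k"])
      (auto simp: pm t_def Suc_diff_le simp del: of_nat_Suc)
  then have "(\<Sum>a<p. of_nat a ^ m) = (\<Sum>k\<le>m. t k)"
    using p0 by (simp add: sum_distrib_left[symmetric])
  also have "\<dots> = of_nat p * bernoulli m + (\<Sum>k<m. t k)"
    unfolding lessThan_Suc_atMost[symmetric] by (simp add: t_def pm del: of_nat_Suc)
  finally have eq: "(\<Sum>a<p. of_nat a ^ m) = of_nat p * bernoulli m + (\<Sum>k<m. t k)" .
  have "\<exists>z \<in> p_integers p. t k = of_nat p ^ 2 * z" if k: "k < m" for k
  proof -
    have B: "bernoulli k \<in> p_integers p" using bernoulli_p_integer k by (simp add: m_def)
    show ?thesis
    proof (cases "Suc k = m")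
      case True
      then have "p dvd (p choose k)" using p pm prime by (intro dvd_choose_prime) auto
      then obtain c where c: "p choose k = p * c" by blast
      have "m - k = 1" using True by simp
      then have "t k = of_nat p ^ 2 * (of_nat c * bernoulli k)"
        unfolding t_def c by (simp add: power2_eq_square)
      then show ?thesis using B by (auto intro: p_integers_intros)
    next
      case False
      then have "m - k = 2 + (m - k - 2)" using k by simp
      then have "t k = of_nat p ^ 2 * (of_nat (p choose k) * bernoulli k * of_nat p ^ (m - k - 2))"
        unfolding t_def by (metis mult.left_commute power_add)
      then show ?thesis using B by (auto intro: p_integers_intros)
    qed
  qed
  then obtain z where z: "\<And>k. k < m \<Longrightarrow> z k \<in> p_integers p \<and> t k = of_nat p ^ 2 * z k" by metis
  have "(\<Sum>k<m. t k) = of_nat p ^ 2 * (\<Sum>k<m. z k)" using z by (simp add: sum_distrib_left)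
  with eq z show ?thesis
    unfolding m_def[symmetric] by (intro pcongI[of "\<Sum>k<m. z k"]) (auto intro: p_integers_intros)
qed

section \<open>Fermat quotients and the Wilson quotient\<close>

lemma prod_one_plus_p_cong:
  fixes f :: "'a \<Rightarrow> int"
  assumes "finite S"
  shows "[(\<Prod>a\<in>S. 1 + int p * f a) = 1 + int p * sum f S] (mod int p ^ 2)"
  using assms
proof (induction S)
  case (insert a S)
  have "[(\<Prod>a\<in>insert a S. 1 + int p * f a) = (1 + int p * f a) * (1 + int p * sum f S)] (mod int p ^ 2)"
    using insert by (simp add: cong_scalar_left)
  also have "(1 + int p * f a) * (1 + int p * sum f S) =
      1 + int p * sum f (insert a S) + int p ^ 2 * (f a * sum f S)"
    using insert by (simp add: algebra_simps power2_eq_square)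
  also have "[\<dots> = 1 + int p * sum f (insert a S)] (mod int p ^ 2)" by (simp add: cong_iff_dvd_diff)
  finally show ?case .
qed simp

text \<open>With $a^{p-1} = 1 + p q_a$ and $(p-1)! = -1 + p w$, expanding $\prod_a a^{p-1} = ((p-1)!)^{p-1}$
  modulo $p^2$ gives $\sum_a q_a \equiv w$.\<close>

lemma sum_power_fact_cong:
  assumes "odd p"
  shows "[(\<Sum>a<p. int a ^ (p - 1)) = int p + fact (p - 1)] (mod int p ^ 2)"
proof -
  have p: "p \<ge> 3" using assms prime prime_ge_2_nat[of p] by (cases "p = 2") auto
  have "\<exists>q. int a ^ (p - 1) = 1 + int p * q" if a: "a \<in> {1..<p}" for a
  proof -
    have "\<not> p dvd a" using a by (auto dest: dvd_imp_le)
    then have "[a ^ (p - 1) = 1] (mod p)" using fermat_theorem[OF prime] by simp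
    then have "[int a ^ (p - 1) = 1] (mod int p)" using cong_int_iff[of "a ^ (p - 1)" 1 p] by simp
    then have "int p dvd int a ^ (p - 1) - 1" by (simp add: cong_iff_dvd_diff)
    then obtain q where "int a ^ (p - 1) - 1 = int p * q" by blast
    then show ?thesis by (intro exI[of _ q]) simp
  qed
  then obtain q where q: "\<And>a. a \<in> {1..<p} \<Longrightarrow> int a ^ (p - 1) = 1 + int p * q a" by metis
  have "[fact (p - 1) = - 1] (mod int p)" using wilson_theorem[OF prime] .
  then have "int p dvd fact (p - 1) + 1" by (simp add: cong_iff_dvd_diff)
  then obtain w where "fact (p - 1) + 1 = int p * w" by blast
  then have w: "fact (p - 1) = - 1 + int p * w" by simp
  have s: "{1..<p} = {1..p - 1}" using p by auto
  \<comment> \<open>There are \<open>p - 1\<close> summands \<open>- w\<close>, so \<open>p\<close>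
    times their sum is \<open>p * w - p^2 * w\<close>; the last term is the extra multiple of
    \<open>p^2\<close>.\<close>
  have "1 + int p * sum q {1..<p} - (1 + int p * (\<Sum>a\<in>{1..<p}. - w)) =
      int p * (sum q {1..<p} - w) + int p ^ 2 * w"
    using p by (simp add: algebra_simps power2_eq_square of_nat_diff)
  moreover have "[1 + int p * sum q {1..<p} = 1 + int p * (\<Sum>a\<in>{1..<p}. - w)] (mod int p ^ 2)"
  proof -
    have "(\<Prod>a\<in>{1..<p}. 1 + int p * q a) = (\<Prod>a\<in>{1..<p}. int a ^ (p - 1))"
      using q by simp
    also have "\<dots> = fact (p - 1) ^ (p - 1)"
      unfolding prod_power_distrib[symmetric] s fact_prod by simp
    also have "\<dots> = (1 + int p * - w) ^ (p - 1)"
    proof -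
      have "even (p - 1)" using assms p by simp
      then have "(- (- 1 + int p * w)) ^ (p - 1) = (- 1 + int p * w) ^ (p - 1)"
        by (rule power_minus_even)
      moreover have "- (- 1 + int p * w) = 1 + int p * - w" by simp
      ultimately show ?thesis unfolding w by metis
    qed
    also have "\<dots> = (\<Prod>a\<in>{1..<p}. 1 + int p * - w)" by simp
    finally have "(\<Prod>a\<in>{1..<p}. 1 + int p * q a) = (\<Prod>a\<in>{1..<p}. 1 + int p * - w)" .
    then show ?thesis
      using prod_one_plus_p_cong[of "{1..<p}" q] prod_one_plus_p_cong[of "{1..<p}" "\<lambda>_. - w"]
      by (metis (no_types, lifting) cong_sym cong_trans finite_atLeastLessThan)
  qed
  ultimately have dvd: "int p ^ 2 dvd int p * (sum q {1..<p} - w)"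
    by (metis cong_iff_dvd_diff dvd_add_left_iff dvd_triv_left)
  have "{..<p} = insert 0 {1..<p}" using p by auto
  then have "(\<Sum>a<p. int a ^ (p - 1)) = (\<Sum>a\<in>{1..<p}. int a ^ (p - 1))" using p by simp
  also have "\<dots> = (\<Sum>a\<in>{1..<p}. 1 + int p * q a)" using q by simp
  also have "\<dots> = int p + fact (p - 1) + int p * (sum q {1..<p} - w)"
    using p unfolding w by (simp add: sum.distrib sum_distrib_left algebra_simps of_nat_diff)
  finally show ?thesis using dvd by (simp add: cong_iff_dvd_diff)
qed

text \<open>The power sum of exponent \<open>p - 1\<close> has been evaluated twice, as
  \<open>p + (p-1)!\<close> and as \<open>p * bernoulli (p - 1)\<close>. Integrality of the
  quotient, which is the von Staudt-Clausen property of this Bernoulli number, then follows from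
  Wilson's theorem.\<close>

lemma agoh_giuga_fact:
  assumes "odd p"
  shows "agoh_giuga p \<in> p_integers p"
    and "pcong p 2 (fact (p - 1)) (of_nat p * agoh_giuga p - 1 - of_nat p)"
proof -
  have p: "(of_nat p :: rat) \<noteq> 0" using prime by (auto simp: prime_gt_0_nat)
  have pA: "of_nat p * agoh_giuga p = of_nat p * bernoulli (p - 1) + 1"
    using p by (simp add: agoh_giuga_def)
  have "pcong p 2 (\<Sum>a<p. of_nat a ^ (p - 1)) (of_nat p + fact (p - 1))"
    using pcong_of_int[OF sum_power_fact_cong[OF assms]] by simp
  then have "pcong p 2 (of_nat p + fact (p - 1)) (of_nat p * bernoulli (p - 1))"
    using sum_power_bernoulli[OF assms] pcong_sym pcong_trans by blast
  then obtain z where z: "z \<in> p_integers p"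
    "of_nat p + fact (p - 1) = of_nat p * bernoulli (p - 1) + of_nat p ^ 2 * z" by (rule pcongE)
  then show "pcong p 2 (fact (p - 1)) (of_nat p * agoh_giuga p - 1 - of_nat p)"
    unfolding pA by (intro pcongI[of z]) (auto simp: algebra_simps)
  have "[fact (p - 1) = - 1] (mod int p)" using wilson_theorem[OF prime] .
  then have "pcong p 1 (fact (p - 1)) (- 1)" using pcong_of_int[of "fact (p - 1)" "-1" 1] by simp
  then obtain w where w: "w \<in> p_integers p" "fact (p - 1) = - 1 + of_nat p * w"
    by (auto elim: pcongE)
  have "of_nat p * agoh_giuga p = of_nat p * (1 + w - of_nat p * z)"
    using z(2) w(2) unfolding pA by (simp add: algebra_simps power2_eq_square)
  then have "agoh_giuga p = 1 + w - of_nat p * z" using p by simp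
  then show "agoh_giuga p \<in> p_integers p" using z w by (auto intro: p_integers_intros)
qed

end

subsection \<open>The odd harmonic number modulo $p^2$\<close>

lemma halves_decomp:
  fixes m :: nat
  shows
  "{1..2 * m} = {1..m} \<union> (\<lambda>j. 2 * m + 1 - j) ` {1..m}"
  "{1..m} \<inter> (\<lambda>j. 2 * m + 1 - j) ` {1..m} = {}"
  "inj_on (\<lambda>j. 2 * m + 1 - j) {1..m}"
proof -
  have "k \<in> (\<lambda>j. 2 * m + 1 - j) ` {1..m}" if "k \<in> {1..2 * m}" "k \<notin> {1..m}" for k
    using that by (intro image_eqI[of _ _ "2 * m + 1 - k"]) auto
  then have "{1..2 * m} \<subseteq> {1..m} \<union> (\<lambda>j. 2 * m + 1 - j) ` {1..m}" by blast
  then show "{1..2 * m} = {1..m} \<union> (\<lambda>j. 2 * m + 1 - j) ` {1..m}"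
    by (rule subset_antisym) auto
qed (auto simp: inj_on_def)

text \<open>With \<open>p = 2 * m + 1\<close> the odd numbers below \<open>p\<close> are the
  \<open>p - 2 j\<close>, hence negatives of even numbers modulo \<open>p\<close>. For
  \<open>m = 0\<close> the bound is truncated to 0 and both sides are empty.\<close>

lemma odd_image: "{k :: nat. odd k \<and> k \<le> 2 * m + 1 - 2} = (\<lambda>j. 2 * m + 1 - 2 * j) ` {1..m}"
proof (cases "m = 0")
  case False
  have "k \<in> (\<lambda>j. 2 * m + 1 - 2 * j) ` {1..m}" if k: "odd k" "k \<le> 2 * m + 1 - 2" for k
  proof -
    obtain i where "k = 2 * i + 1" using k by (elim oddE)
    then show ?thesis using k False by (intro image_eqI[of _ _ "m - i"]) auto
  qed
  then show ?thesis using False by auto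
qed (auto elim: oddE)

lemma parity_decomp:
  fixes m :: nat
  shows
  "{1..2 * m} = (\<lambda>j. 2 * j) ` {1..m} \<union> (\<lambda>j. 2 * m + 1 - 2 * j) ` {1..m}"
  "(\<lambda>j. 2 * j) ` {1..m} \<inter> (\<lambda>j. 2 * m + 1 - 2 * j) ` {1..m} = {}"
  "inj_on (\<lambda>j. 2 * j) {1..m}" "inj_on (\<lambda>j. 2 * m + 1 - 2 * j) {1..m}"
proof -
  have "k \<in> (\<lambda>j. 2 * j) ` {1..m} \<union> (\<lambda>j. 2 * m + 1 - 2 * j) ` {1..m}"
    if k: "k \<in> {1..2 * m}" for k
  proof (cases "even k")
    case True
    then show ?thesis using k by auto
  next
    case False
    then have "k \<le> 2 * m + 1 - 2" using k by (cases "k = 2 * m") auto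
    then show ?thesis using odd_image[of m] False by auto
  qed
  then have "{1..2 * m} \<subseteq> (\<lambda>j. 2 * j) ` {1..m} \<union> (\<lambda>j. 2 * m + 1 - 2 * j) ` {1..m}" by blast
  then show "{1..2 * m} = (\<lambda>j. 2 * j) ` {1..m} \<union> (\<lambda>j. 2 * m + 1 - 2 * j) ` {1..m}"
    by (rule subset_antisym) auto
  \<comment> \<open>For \<open>j \<le> m\<close> the subtraction is not truncated, so the right side
    is odd.\<close>
  have "2 * i \<noteq> 2 * m + 1 - 2 * j" if "j \<in> {1..m}" for i j
    using that unfolding atLeastAtMost_iff by presburger
  then show "(\<lambda>j. 2 * j) ` {1..m} \<inter> (\<lambda>j. 2 * m + 1 - 2 * j) ` {1..m} = {}" by blast
qed (auto simp: inj_on_def)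


lemma prod_halves:
  fixes m :: nat
  shows "prod f {1..2 * m} = prod f {1..m} * (\<Prod>j=1..m. f (2 * m + 1 - j))"
  by (subst halves_decomp(1), subst prod.union_disjoint)
    (use halves_decomp in \<open>auto simp: prod.reindex\<close>)

lemma sum_halves:
  fixes m :: nat
  shows "sum f {1..2 * m} = sum f {1..m} + (\<Sum>j=1..m. f (2 * m + 1 - j))"
  by (subst halves_decomp(1), subst sum.union_disjoint)
    (use halves_decomp in \<open>auto simp: sum.reindex\<close>)

lemma prod_parity:
  fixes m :: nat
  shows "prod f {1..2 * m} = (\<Prod>j=1..m. f (2 * j)) * (\<Prod>j=1..m. f (2 * m + 1 - 2 * j))"
  by (subst parity_decomp(1), subst prod.union_disjoint)
    (use parity_decomp in \<open>auto simp: prod.reindex\<close>)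

lemma sum_parity:
  fixes m :: nat
  shows "sum f {1..2 * m} = (\<Sum>j=1..m. f (2 * j)) + (\<Sum>j=1..m. f (2 * m + 1 - 2 * j))"
  by (subst parity_decomp(1), subst sum.union_disjoint)
    (use parity_decomp in \<open>auto simp: sum.reindex\<close>)

context
  fixes p :: nat
  assumes prime: "prime p" and gt3: "p > 3"
begin

lemmas Zp = p_integers_intros[OF prime]

lemma odd_p: "odd p"
  using prime gt3 prime_odd_nat by auto

lemma p_integers_half:
  assumes "x \<in> p_integers p" shows "x / 2 \<in> p_integers p"
proof -
  have "\<not> p dvd 2" using gt3 by (auto dest: dvd_imp_le)
  then show ?thesis using p_integers_divide_of_nat[OF prime assms, of 2] by simp
qed

lemma p_integers_quarter: "x \<in> p_integers p \<Longrightarrow> x / 4 \<in> p_integers p"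
  using p_integers_half[OF p_integers_half, of x] by simp

lemma p_integers_eighth: "x \<in> p_integers p \<Longrightarrow> x / 8 \<in> p_integers p"
  using p_integers_half[OF p_integers_quarter, of x] by simp

text \<open>The second elementary symmetric sum is written through power sums by Newton's identity.
  The expansion goes up to \<open>p^3\<close> because a factor \<open>p\<close> is cancelled later
  and precision \<open>p^2\<close> must remain.\<close>

lemma prod_one_minus_p_expansion:
  assumes "finite S" "\<And>j. j \<in> S \<Longrightarrow> u j \<in> p_integers p"
  shows "\<exists>z\<in>p_integers p. (\<Prod>j\<in>S. 1 - of_nat p * u j) =
    1 - of_nat p * sum u S + of_nat p ^ 2 * ((sum u S ^ 2 - (\<Sum>j\<in>S. u j ^ 2)) / 2) + of_nat p ^ 3 * z"
  using assms
proof (induction S)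
  case empty
  then show ?case by (intro bexI[of _ 0]) (auto intro: Zp)
next
  case (insert j S)
  define e s where "e = sum u S" and "s = (\<Sum>j\<in>S. u j ^ 2)"
  have es: "e \<in> p_integers p" "s \<in> p_integers p" "u j \<in> p_integers p"
    unfolding e_def s_def using insert.prems by (auto intro!: Zp)
  obtain z where z: "z \<in> p_integers p" "(\<Prod>j\<in>S. 1 - of_nat p * u j) =
    1 - of_nat p * e + of_nat p ^ 2 * ((e ^ 2 - s) / 2) + of_nat p ^ 3 * z"
    using insert unfolding e_def s_def by auto
  have "(\<Prod>j\<in>insert j S. 1 - of_nat p * u j) = (1 - of_nat p * u j) * 
    (1 - of_nat p * e + of_nat p ^ 2 * ((e ^ 2 - s) / 2) + of_nat p ^ 3 * z)"
    using insert.hyps z(2) by simp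
  also have "\<dots> = 1 - of_nat p * (u j + e) + of_nat p ^ 2 * (((u j + e) ^ 2 - (u j ^ 2 + s)) / 2)
    + of_nat p ^ 3 * (z - of_nat p * u j * z - u j * ((e ^ 2 - s) / 2))"
    by (simp add: field_simps power2_eq_square power3_eq_cube)
  finally show ?case
    using insert.hyps z(1) es unfolding e_def s_def
    by (intro bexI[of _ "z - of_nat p * u j * z - u j * ((e ^ 2 - s) / 2)"])
      (auto simp: e_def s_def intro!: Zp p_integers_half)
qed

lemma inverse_p_minus_square:
  assumes "1 / x \<in> p_integers p" "1 / (of_nat p - x) \<in> p_integers p" "x \<in> p_integers p"
    "x \<noteq> 0" "of_nat p \<noteq> x"
  shows "pcong p 1 (1 / (of_nat p - x) ^ 2) (1 / x ^ 2)"
proof (rule pcongI)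
  \<comment> \<open>The witness comes from \<open>x^2 - (p - x)^2 = p * (2 * x - p)\<close>.\<close>
  show "(2 * x - of_nat p) * (1 / x) ^ 2 * (1 / (of_nat p - x)) ^ 2 \<in> p_integers p"
    using assms by (intro Zp)
  show "1 / (of_nat p - x) ^ 2 = 1 / x ^ 2 +
      of_nat p ^ 1 * ((2 * x - of_nat p) * (1 / x) ^ 2 * (1 / (of_nat p - x)) ^ 2)"
    using assms(4,5) by (simp add: divide_simps) (simp add: algebra_simps power2_eq_square)
qed (use prime in auto)

lemma pcong_sum:
  assumes "\<And>j. j \<in> S \<Longrightarrow> pcong p n (f j) (g j)"
  shows "pcong p n (sum f S) (sum g S)"
proof -
  have "\<forall>j\<in>S. \<exists>z. z \<in> p_integers p \<and> f j = g j + of_nat p ^ n * z"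
    using assms by (blast elim: pcongE[OF prime])
  then obtain z where "\<forall>j\<in>S. z j \<in> p_integers p \<and> f j = g j + of_nat p ^ n * z j" by metis
  then show ?thesis
    by (intro pcongI[OF prime, of "sum z S"]) (auto simp: sum.distrib sum_distrib_left intro!: Zp)
qed

lemma p_integers_inverse_less:
  assumes "j \<in> {1..<p}"
  shows "1 / of_nat j \<in> p_integers p" "1 / (of_nat p - of_nat j) \<in> p_integers p"
proof -
  have "\<not> p dvd j" "\<not> p dvd p - j" using assms by (auto dest: dvd_imp_le)
  then show "1 / of_nat j \<in> p_integers p" "1 / (of_nat p - of_nat j) \<in> p_integers p"
    using p_integers_inverse_of_nat[OF prime, of j] p_integers_inverse_of_nat[OF prime, of "p - j"] assms
    by (auto simp: of_nat_diff)
qed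

text \<open>Splitting $\sum_{k<p} k^{-2}$ into $j, p - j$ and into $2j, p - 2j$ with $j < p/2$ gives
  $2 s \equiv \frac12 s$ for $s = \sum_{j<p/2} j^{-2}$.\<close>

lemma half_sum_inverse_squares:
  assumes m: "p = 2 * m + 1"
  shows "\<exists>z\<in>p_integers p. (\<Sum>j=1..m. 1 / of_nat j ^ 2) = of_nat p * z"
proof -
  define s where "s = (\<Sum>j=1..m. 1 / of_nat j ^ 2 :: rat)"
  define f where "f k = (1 / of_nat k ^ 2 :: rat)" for k :: nat
  have 1: "pcong p 1 (\<Sum>j=1..m. f (2 * m + 1 - j)) s"
    unfolding s_def
  proof (rule pcong_sum)
    fix j assume j: "j \<in> {1..m}"
    then have "pcong p 1 (1 / (of_nat p - of_nat j) ^ 2) (1 / of_nat j ^ 2)"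
      using m p_integers_inverse_less[of j] by (intro inverse_p_minus_square Zp) auto
    moreover have "of_nat (2 * m + 1 - j) = (of_nat p - of_nat j :: rat)"
      using j m by (simp add: of_nat_diff)
    ultimately show "pcong p 1 (f (2 * m + 1 - j)) (1 / of_nat j ^ 2)" unfolding f_def by simp
  qed
  have 2: "pcong p 1 (\<Sum>j=1..m. f (2 * m + 1 - 2 * j)) (\<Sum>j=1..m. f (2 * j))"
  proof (rule pcong_sum)
    fix j assume j: "j \<in> {1..m}"
    then have "pcong p 1 (1 / (of_nat p - of_nat (2 * j)) ^ 2) (1 / of_nat (2 * j) ^ 2)"
      using m p_integers_inverse_less[of "2 * j"] by (intro inverse_p_minus_square Zp) (auto simp flip: of_nat_mult)
    moreover have "of_nat (2 * m + 1 - 2 * j) = (of_nat p - of_nat (2 * j) :: rat)"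
      using j m by (simp add: of_nat_diff)
    ultimately show "pcong p 1 (f (2 * m + 1 - 2 * j)) (f (2 * j))" unfolding f_def by simp
  qed
  have q: "(\<Sum>j=1..m. f (2 * j)) = s / 4"
    unfolding s_def f_def sum_divide_distrib by (intro sum.cong) (auto simp: power_mult_distrib)
  obtain u where u: "u \<in> p_integers p" "(\<Sum>j=1..m. f (2 * m + 1 - j)) = s + of_nat p * u"
    using 1 by (auto elim: pcongE[OF prime])
  obtain v where v: "v \<in> p_integers p" "(\<Sum>j=1..m. f (2 * m + 1 - 2 * j)) = s / 4 + of_nat p * v"
    using 2 q by (auto elim: pcongE[OF prime])
  have "s + (s + of_nat p * u) = s / 4 + (s / 4 + of_nat p * v)"
    using sum_halves[of f m] sum_parity[of f m] u(2) v(2) q by (simp add: s_def f_def)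
  \<comment> \<open>The equation reads \<open>3 * s / 2 = p * (v - u)\<close>, and
    \<open>p > 3\<close> makes 3 invertible.\<close>
  then have "s = of_nat p * (2 * (v - u) / of_nat 3)" by (simp add: field_simps)
  moreover have "\<not> p dvd 3" using gt3 by (auto dest: dvd_imp_le)
  then have "2 * (v - u) / of_nat 3 \<in> p_integers p"
    by (intro p_integers_divide_of_nat[OF prime] Zp u v)
  ultimately show ?thesis unfolding s_def by blast
qed

text \<open>Comparing $(p-1)! = \prod_{j<p/2} j (p-j)$ with $(p-1)! = \prod_{j<p/2} 2j (p-2j)$.\<close>

lemma prod_one_minus_p_halves:
  assumes m: "p = 2 * m + 1"
  shows "(\<Prod>j=1..m. 1 - of_nat p * (1 / of_nat j :: rat)) =
    2 ^ (p - 1) * (\<Prod>j=1..m. 1 - of_nat p * (1 / (2 * of_nat j)))"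
proof -
  define M where "M = (\<Prod>j=1..m. of_nat j :: rat)"
  have M: "M \<noteq> 0" unfolding M_def by simp
  have 1: "(\<Prod>j=1..m. of_nat (2 * m + 1 - j)) =
    (- 1) ^ m * M * (\<Prod>j=1..m. 1 - of_nat p * (1 / of_nat j :: rat))"
  proof -
    have "(\<Prod>j=1..m. of_nat (2 * m + 1 - j)) =
      (\<Prod>j=1..m. (- 1) * of_nat j * (1 - of_nat p * (1 / of_nat j :: rat)))"
      by (intro prod.cong) (auto simp: of_nat_diff m field_simps)
    also have "\<dots> = (- 1) ^ m * M * (\<Prod>j=1..m. 1 - of_nat p * (1 / of_nat j))"
      unfolding prod.distrib prod_constant M_def by simp
    finally show ?thesis .
  qed
  have 2: "(\<Prod>j=1..m. of_nat (2 * m + 1 - 2 * j)) =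
    (- 1) ^ m * 2 ^ m * M * (\<Prod>j=1..m. 1 - of_nat p * (1 / (2 * of_nat j :: rat)))"
  proof -
    have "(\<Prod>j=1..m. of_nat (2 * m + 1 - 2 * j)) =
      (\<Prod>j=1..m. (- 1) * 2 * of_nat j * (1 - of_nat p * (1 / (2 * of_nat j :: rat))))"
      by (intro prod.cong) (auto simp: of_nat_diff m field_simps)
    also have "\<dots> = (- 1) ^ m * 2 ^ m * M * (\<Prod>j=1..m. 1 - of_nat p * (1 / (2 * of_nat j)))"
      unfolding prod.distrib prod_constant M_def by simp
    finally show ?thesis .
  qed
  have 3: "(\<Prod>j=1..m. of_nat (2 * j)) = 2 ^ m * M"
    by (simp add: prod.distrib M_def)
  have 4: "(2 ^ (p - 1) :: rat) = 2 ^ m * 2 ^ m" by (simp add: m mult_2 power_add)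
  have "M * ((- 1) ^ m * M * (\<Prod>j=1..m. 1 - of_nat p * (1 / of_nat j :: rat))) =
    2 ^ m * M * ((- 1) ^ m * 2 ^ m * M * (\<Prod>j=1..m. 1 - of_nat p * (1 / (2 * of_nat j))))"
    using prod_halves[of "of_nat :: nat \<Rightarrow> rat" m] prod_parity[of "of_nat :: nat \<Rightarrow> rat" m]
    unfolding 1 2 3 by (simp add: M_def)
  then show ?thesis unfolding 4 using M by (simp add: mult_ac)
qed

text \<open>Expanding \<open>1 / (p - 2 j)\<close> in powers of \<open>p\<close> with exact
  remainder gives \<open>- 1 / (2 j) - p / (4 j^2)\<close> up to \<open>p^2\<close>. The second
  terms add up to a multiple of \<open>p^2\<close> because the sum of inverse squares is itself
  divisible by \<open>p\<close>.\<close>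

lemma odd_harmonic_half_harmonic:
  assumes m: "p = 2 * m + 1"
  shows "pcong p 2 (odd_harmonic p) (- (\<Sum>j=1..m. 1 / of_nat j) / 2)"
proof -
  obtain z where z: "z \<in> p_integers p" "(\<Sum>j=1..m. 1 / of_nat j ^ 2) = of_nat p * z"
    using half_sum_inverse_squares[OF m] by blast
  define w where "w j = (1 / of_nat (2 * j)) ^ 2 * (1 / (of_nat p - of_nat (2 * j)) :: rat)" for j
  have "odd_harmonic p = (\<Sum>j=1..m. 1 / of_nat (2 * m + 1 - 2 * j))"
    unfolding odd_harmonic_def m odd_image using parity_decomp(4)[of m] by (subst sum.reindex) auto
  also have "\<dots> = (\<Sum>j=1..m. - (1 / of_nat j) / 2 - of_nat p * ((1 / of_nat j ^ 2) / 4)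
      + of_nat p ^ 2 * w j)"
  proof (intro sum.cong refl)
    fix j assume j: "j \<in> {1..m}"
    then have e: "of_nat (2 * m + 1 - 2 * j) = (of_nat p - 2 * of_nat j :: rat)"
      using m by (simp add: of_nat_diff)
    have expand: "1 / (x - 2 * y) = - (1 / y) / 2 - x * ((1 / y ^ 2) / 4)
      + x ^ 2 * ((1 / (2 * y)) ^ 2 * (1 / (x - 2 * y)))"
      if "y \<noteq> 0" "x - 2 * y \<noteq> 0" for x y :: rat
      using that by (simp add: divide_simps) (simp add: algebra_simps power2_eq_square)
    have "of_nat p \<noteq> (of_nat (2 * j) :: rat)" unfolding of_nat_eq_iff using m j by arith
    then show "1 / of_nat (2 * m + 1 - 2 * j) = - (1 / of_nat j) / 2
      - of_nat p * ((1 / of_nat j ^ 2) / 4) + of_nat p ^ 2 * w j"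
      unfolding e w_def of_nat_mult of_nat_numeral using j by (intro expand) auto
  qed
  also have "\<dots> = - (\<Sum>j=1..m. 1 / of_nat j) / 2 - of_nat p * ((\<Sum>j=1..m. 1 / of_nat j ^ 2) / 4)
      + of_nat p ^ 2 * (\<Sum>j=1..m. w j)"
    by (simp add: sum.distrib sum_subtractf sum_distrib_left sum_divide_distrib sum_negf)
  also have "\<dots> = - (\<Sum>j=1..m. 1 / of_nat j) / 2 + of_nat p ^ 2 * ((\<Sum>j=1..m. w j) - z / 4)"
    unfolding z(2) by (simp add: algebra_simps power2_eq_square)
  finally show ?thesis
  proof (rule pcongI[OF prime, rotated])
    have "w j \<in> p_integers p" if "j \<in> {1..m}" for j
      unfolding w_def using that m p_integers_inverse_less[of "2 * j"] by (intro Zp) auto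
    then show "(\<Sum>j=1..m. w j) - z / 4 \<in> p_integers p"
      using z(1) by (intro Zp p_integers_quarter)
  qed
qed

text \<open>For the half harmonic sum \<open>h\<close>, comparing the two products and cancelling
  \<open>p\<close> gives \<open>h = - 2 q + p (3 h^2 / 4 + q h)\<close> modulo \<open>p^2\<close>.
  Substituting \<open>h = - 2 q\<close> into the bracket turns it into \<open>q^2\<close>.\<close>

lemma odd_harmonic_fermat_quotient:
  assumes q: "2 ^ (p - 1) = 1 + of_nat p * q" "q \<in> p_integers p"
  shows "pcong p 2 (odd_harmonic p) (q - of_nat p * q ^ 2 / 2)"
proof -
  obtain m where m: "p = 2 * m + 1" using odd_p by (elim oddE)
  define P where "P = (of_nat p :: rat)"
  have P: "P \<noteq> 0" "P \<in> p_integers p" using gt3 by (auto simp: P_def intro: Zp)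
  define h where "h = (\<Sum>j=1..m. 1 / of_nat j :: rat)"
  obtain z where z: "z \<in> p_integers p" "(\<Sum>j=1..m. 1 / of_nat j ^ 2) = P * z"
    using half_sum_inverse_squares[OF m] unfolding P_def by blast
  have j: "1 / of_nat j \<in> p_integers p" "1 / (2 * of_nat j) \<in> p_integers p" if "j \<in> {1..m}" for j
    using that m p_integers_inverse_less(1)[of j] p_integers_inverse_less(1)[of "2 * j"] by auto
  have h: "h \<in> p_integers p" unfolding h_def using j by (intro Zp)
  define X Y where "X = (\<Prod>j=1..m. 1 - P * (1 / of_nat j))"
    and "Y = (\<Prod>j=1..m. 1 - P * (1 / (2 * of_nat j)))"
  have XY: "X = (1 + P * q) * Y"
    using prod_one_minus_p_halves[OF m] q(1) unfolding X_def Y_def P_def by simp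
  obtain x where x: "x \<in> p_integers p" "X = 1 - P * h + P ^ 2 * ((h ^ 2 - P * z) / 2) + P ^ 3 * x"
    using prod_one_minus_p_expansion[of "{1..m}" "\<lambda>j. 1 / of_nat j"] j
    by (auto simp: X_def h_def P_def[symmetric] z(2)[symmetric] power_divide)
  have "(\<Sum>j=1..m. 1 / (2 * of_nat j)) = h / 2" "(\<Sum>j=1..m. (1 / (2 * of_nat j)) ^ 2) = P * z / 4"
    by (simp_all add: h_def z(2)[symmetric] sum_divide_distrib power_divide power_mult_distrib mult.commute)
  then obtain y where y: "y \<in> p_integers p"
    "Y = 1 - P * (h / 2) + P ^ 2 * (((h / 2) ^ 2 - P * z / 4) / 2) + P ^ 3 * y"
    using prod_one_minus_p_expansion[of "{1..m}" "\<lambda>j. 1 / (2 * of_nat j)"] j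
    by (auto simp: Y_def P_def[symmetric])
  \<comment> \<open>\<open>P ^ 3 * W\<close> gathers all terms of order at least 3 in
    \<open>X - (1 + P * q) * Y\<close>; the sums of squares belong here since they equal
    \<open>P\<close> times a p-integer.\<close>
  define W where "W = x - y - 3 * z / 8 - q * h ^ 2 / 8 + P * q * z / 8 - P * q * y"
  have W: "W \<in> p_integers p" unfolding W_def
    by (intro Zp p_integers_eighth x y z q h P)
  define T where "T = 3 * h ^ 2 / 4 + q * h + 2 * P * W"
  have T: "T \<in> p_integers p" unfolding T_def
    by (intro Zp p_integers_quarter x y z q h P W)
  have "P * (h - (- 2 * q + P * T)) = 0"
    using XY unfolding x(2) y(2) T_def W_def
    by (simp add: field_simps power2_eq_square power3_eq_cube)
  then have hT: "h = - 2 * q + P * T" using P by simp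
  define U where "U = - 2 * q * T + 3 * P * T ^ 2 / 4"
  have U: "U \<in> p_integers p" unfolding U_def
    by (intro Zp p_integers_quarter q P T)
  \<comment> \<open>One substitution suffices, because \<open>T\<close> enters \<open>h\<close> only
    with a factor \<open>P\<close>; \<open>U\<close> is the resulting error.\<close>
  have "T = 3 * (- 2 * q + P * T) ^ 2 / 4 + q * (- 2 * q + P * T) + 2 * P * W"
    unfolding hT[symmetric] by (rule T_def)
  also have "\<dots> = q ^ 2 + P * U + 2 * P * W"
    unfolding U_def by (simp add: field_simps power2_eq_square)
  finally have "T = q ^ 2 + P * U + 2 * P * W" .
  then have "h = - 2 * q + P * (q ^ 2 + P * U + 2 * P * W)" using hT by simp
  then have "pcong p 2 (- h / 2) (q - of_nat p * q ^ 2 / 2)"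
    by (intro pcongI[OF prime, of "- U / 2 - W"])
      (auto simp: P_def field_simps power2_eq_square intro!: Zp U W p_integers_half)
  then show ?thesis
    using odd_harmonic_half_harmonic[OF m] pcong_trans[OF prime] unfolding h_def by blast
qed

end

subsection \<open>Comparison of digits\<close>

text \<open>Multiplication by \<open>p - 1\<close> makes both parts of \<open>2 * N\<close>
  accessible: \<open>(p - 2)!\<close> becomes \<open>(p - 1)!\<close>, and the Eulerian value
  becomes the Bernoulli expression. As \<open>p - 1\<close> is a unit modulo \<open>p\<close>, it
  can be divided out at the end.\<close>

lemma twice_num_even_ascents:
  assumes "prime p" "p > 3"
  defines "P \<equiv> of_nat p :: rat" and "H \<equiv> odd_harmonic p" and "A \<equiv> agoh_giuga p"
  shows "pcong p 2 (of_nat (2 * num_even_ascents (p - 2)))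
    (1 + H + P * (3 / 2 * H ^ 2 + H + 2 - A * (1 + H)))"
proof -
  note Zp = p_integers_intros[OF assms(1)]
  note half = p_integers_half[OF assms(1,2)]
  have odd: "odd p" using odd_p[OF assms(1,2)] .
  define n where "n = p - 2"
  have n: "n > 0" "p = Suc (Suc n)" "p - 1 = Suc n" using assms(2) by (auto simp: n_def)
  have P: "P \<in> p_integers p" "P \<noteq> 0" using assms(2) by (auto simp: P_def intro: Zp)
  have Pn: "of_nat (Suc n) = P - 1" unfolding P_def n(2) by simp
  have A: "A \<in> p_integers p" unfolding A_def by (rule agoh_giuga_fact[OF assms(1) odd])
  have PB: "P * bernoulli (Suc n) = P * A - 1"
    using P unfolding A_def agoh_giuga_def P_def[symmetric] n(3) by simp
  have "\<not> p dvd 2" using assms(2) by (auto dest: dvd_imp_le)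
  then have "[2 ^ (p - 1) = 1] (mod p)" using fermat_theorem[OF assms(1)] by simp
  then have "[int (2 ^ (p - 1)) = int 1] (mod int p ^ 1)" unfolding power_one_right cong_int_iff .
  then have "pcong p 1 (2 ^ (p - 1)) 1"
    using pcong_of_int[OF assms(1), of "int (2 ^ (p - 1))" "int 1" 1] by simp
  then obtain q where q: "q \<in> p_integers p" "2 ^ (p - 1) = 1 + P * q"
    by (auto elim: pcongE[OF assms(1)] simp: P_def)
  have "pcong p 2 H (q - P * q ^ 2 / 2)"
    unfolding H_def P_def using odd_harmonic_fermat_quotient[OF assms(1,2)] q P_def by blast
  then obtain z2 where z2: "z2 \<in> p_integers p" "H = q - P * q ^ 2 / 2 + P ^ 2 * z2"
    unfolding P_def by (elim pcongE[OF assms(1)])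
  have "pcong p 2 (fact (p - 1)) (P * A - 1 - P)"
    unfolding A_def P_def by (rule agoh_giuga_fact[OF assms(1) odd])
  then obtain z1 where z1: "z1 \<in> p_integers p" "fact (p - 1) = P * A - 1 - P + P ^ 2 * z1"
    unfolding P_def by (elim pcongE[OF assms(1)])
  define E :: rat where "E = eulerian_poly n (- 1)"
  define x :: rat where "x = of_nat (2 * num_even_ascents n)"
  have x: "x = fact n + E"
    using arg_cong[OF num_even_ascents_eulerian[of n], of "of_int :: int \<Rightarrow> rat"]
      eulerian_poly_of_int[of n "- 1", where ?'a = rat]
    by (simp add: x_def E_def)
  have fact: "(P - 1) * fact n = P * A - 1 - P + P ^ 2 * z1"
    using z1(2) unfolding n(3) fact_Suc Pn .
  \<comment> \<open>The additional \<open>P\<close> clears the denominator of the Bernoulli number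
    and is then cancelled against \<open>2 ^ (p - 1) - 1 = P * q\<close>.\<close>
  have "P * ((P - 1) * E) = (1 + P * q) * (P * q) * (P * bernoulli (Suc n))"
    using eulerian_poly_minus_1[OF n(1)] q(2) unfolding E_def Pn n(3) by simp
  then have E: "(P - 1) * E = (1 + P * q) * q * (P * A - 1)"
    using P(2) unfolding PB by simp
  \<comment> \<open>\<open>k\<close> is chosen so that \<open>H = q + P * k\<close>;
    \<open>V\<close> is the error from replacing \<open>H\<close> by \<open>q\<close> inside the
    bracket, and \<open>Z\<close> is the total error after multiplication by
    \<open>P - 1\<close>.\<close>
  define k where "k = P * z2 - q ^ 2 / 2"
  define V where "V = 3 * q * k + 3 * P * k ^ 2 / 2 + k - A * k"
  define Z where "Z = z1 + q ^ 2 * A - (q ^ 2 + q + 2 - A * (1 + q)) + (1 - P) * (V + z2)"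
  have k: "k \<in> p_integers p" unfolding k_def by (intro Zp half q P z2)
  have V: "V \<in> p_integers p" unfolding V_def by (intro Zp half q P k A)
  have Z: "Z \<in> p_integers p" unfolding Z_def by (intro Zp half q P A z1 z2 V)
  define R where "R = 1 + H + P * (3 / 2 * H ^ 2 + H + 2 - A * (1 + H))"
  have "H = q + P * k" unfolding z2(2) k_def by (simp add: algebra_simps power2_eq_square)
  then have "R = 1 + q + P * (k + 3 / 2 * q ^ 2 + q + 2 - A * (1 + q)) + P ^ 2 * V"
    unfolding R_def V_def by (simp add: field_simps power2_eq_square)
  also have "\<dots> = 1 + q + P * (q ^ 2 + q + 2 - A * (1 + q)) + P ^ 2 * (V + z2)"
    unfolding k_def by (simp add: field_simps power2_eq_square)
  finally have R: "R = 1 + q + P * (q ^ 2 + q + 2 - A * (1 + q)) + P ^ 2 * (V + z2)" .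
  have "(P - 1) * (x - R) = P ^ 2 * Z"
    unfolding x right_diff_distrib distrib_left[of "P - 1" "fact n"] fact E
    unfolding R Z_def by (simp add: algebra_simps power2_eq_square)
  moreover have nz: "P - 1 \<noteq> 0" unfolding Pn[symmetric] by (simp del: of_nat_Suc)
  ultimately have "x = R + P ^ 2 * (Z * (1 / (P - 1)))" by (simp add: field_simps)
  moreover have "1 / (P - 1) \<in> p_integers p"
    using p_integers_inverse_less(1)[OF assms(1,2), of "Suc n"] unfolding Pn by (simp add: n(2))
  ultimately show ?thesis
    unfolding R_def[symmetric] x_def[symmetric] n_def[symmetric]
    using Z by (intro pcongI[OF assms(1), of "Z * (1 / (P - 1))"] Zp) (simp_all add: P_def)
qed

lemma two_padic_digits:
  assumes "prime p" "x \<in> p_integers p"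
  shows "padic_digit p x j < p"
    and "pcong p 2 x (of_nat (padic_digit p x 0) + of_nat p * of_nat (padic_digit p x 1))"
  using padic_expansion_padic_digit[OF assms]
  unfolding padic_expansion_def
  by (auto dest!: spec[of _ "2::nat"] simp: numeral_2_eq_2 mult.commute)

lemma pcong_of_nat_cong:
  assumes "prime p" "pcong p 1 (of_nat a) (of_nat b)" shows "[a = b] (mod p)"
proof -
  obtain z where z: "z \<in> p_integers p" "of_nat a = of_nat b + of_nat p * z"
    using assms(2) by (auto elim: pcongE[OF assms(1)])
  then have "int p dvd int a - int b" by (intro p_integers_small[OF assms(1) _ z(1)]) simp
  then show ?thesis by (simp add: cong_iff_dvd_diff flip: cong_int_iff)
qed

theorem theorem10:
  fixes p :: nat and H :: rat and N :: nat and A :: rat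
  assumes "prime p" and "odd p"
  defines "H \<equiv> odd_harmonic p"
    and "N \<equiv> num_even_ascents (p - 2)"
    and "A \<equiv> agoh_giuga p"
  shows "[padic_digit p (of_nat (2 * N)) 0 = padic_digit p H 0 + 1] (mod p) \<and>
    (p \<noteq> 3 \<longrightarrow>
      pcong p 1
        (of_nat (padic_digit p (of_nat (2 * N)) 1)
          + of_nat (padic_digit p (of_nat (padic_digit p (of_nat (2 * N)) 0) - 1) 1))
        (3 / 2 * of_nat (padic_digit p H 0) ^ 2 + of_nat (padic_digit p H 1)
          + of_nat (padic_digit p H 0) - A * (1 + of_nat (padic_digit p H 0)) + 2))"
proof (cases "p = 3")
  case True
  have "{k :: nat. odd k \<and> k \<le> 1} = {1}" by (auto simp: le_Suc_eq)
  then have "H = of_nat 1" using True by (simp add: H_def odd_harmonic_def)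
  moreover have "N = 1" using True num_even_ascents_1 by (simp add: N_def)
  ultimately have "padic_digit p H 0 = 1" "padic_digit p (of_nat (2 * N)) 0 = 2"
    using padic_digit_of_nat_less[OF assms(1), of 1 0] padic_digit_of_nat_less[OF assms(1), of 2 0] True
    by simp_all
  then show ?thesis using True by (simp add: numeral_2_eq_2)
next
  case False
  then have gt3: "p > 3" using assms prime_ge_2_nat[of p] by (cases "p = 2") auto
  note Zp = p_integers_intros[OF assms(1)]
  note half = p_integers_half[OF assms(1) gt3]
  note pcE = pcongE[OF assms(1)]
  define P where "P = (of_nat p :: rat)"
  have P: "P \<in> p_integers p" "P \<noteq> 0" using gt3 by (auto simp: P_def intro: Zp)
  have H: "H \<in> p_integers p" unfolding H_def by (rule odd_harmonic_p_integer[OF assms(1)])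
  have A: "A \<in> p_integers p" unfolding A_def by (rule agoh_giuga_fact[OF assms(1,2)])
  define x where "x = (of_nat (2 * N) :: rat)"
  have x: "x \<in> p_integers p" unfolding x_def by (rule Zp)
  define n0 n1 h0 h1 m0 m1 where "n0 = (of_nat (padic_digit p x 0) :: rat)"
    and "n1 = (of_nat (padic_digit p x 1) :: rat)"
    and "h0 = (of_nat (padic_digit p H 0) :: rat)" and "h1 = (of_nat (padic_digit p H 1) :: rat)"
    and "m0 = (of_nat (padic_digit p (n0 - 1) 0) :: rat)"
    and "m1 = (of_nat (padic_digit p (n0 - 1) 1) :: rat)"
  have n0: "n0 - 1 \<in> p_integers p" unfolding n0_def by (intro Zp)
  have int: "h0 \<in> p_integers p" "h1 \<in> p_integers p" "n1 \<in> p_integers p" "m1 \<in> p_integers p"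
    unfolding h0_def h1_def n1_def m1_def by (rule Zp)+
  obtain a where a: "a \<in> p_integers p" "x = n0 + P * n1 + P ^ 2 * a"
    using two_padic_digits(2)[OF assms(1) x] unfolding n0_def n1_def P_def by (elim pcE)
  obtain b where b: "b \<in> p_integers p" "H = h0 + P * h1 + P ^ 2 * b"
    using two_padic_digits(2)[OF assms(1) H] unfolding h0_def h1_def P_def by (elim pcE)
  obtain c where c: "c \<in> p_integers p" "n0 - 1 = m0 + P * m1 + P ^ 2 * c"
    using two_padic_digits(2)[OF assms(1) n0] unfolding m0_def m1_def P_def by (elim pcE)
  obtain d where d: "d \<in> p_integers p"
    "x = 1 + H + P * (3 / 2 * H ^ 2 + H + 2 - A * (1 + H)) + P ^ 2 * d"
    using twice_num_even_ascents[OF assms(1) gt3] unfolding x_def N_def H_def A_def P_def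
    by (elim pcE)
  define G where "G = 3 / 2 * H ^ 2 + H + 2 - A * (1 + H)"
  \<comment> \<open>With the division by 2 outermost, closure under halving applies.\<close>
  have "G = 3 * H ^ 2 / 2 + H + 2 - A * (1 + H)" by (simp add: G_def)
  then have G: "G \<in> p_integers p" by (simp only:) (intro Zp half H A)
  have n0h0: "n0 = 1 + h0 + P * (h1 + P * b + G + P * d - n1 - P * a)"
    using a(2) d(2) b(2) unfolding G_def[symmetric]
    by (simp add: algebra_simps power2_eq_square)
  have mod1: "pcong p 1 n0 (1 + h0)"
    by (rule pcongI[OF assms(1), of "h1 + P * b + G + P * d - n1 - P * a"])
      (use n0h0 a b d G int P in \<open>auto simp: P_def[symmetric] intro!: Zp\<close>)
  then have first: "[padic_digit p x 0 = padic_digit p H 0 + 1] (mod p)"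
    by (intro pcong_of_nat_cong[OF assms(1)]) (simp add: n0_def h0_def add.commute)
  \<comment> \<open>Both are digits below \<open>p\<close>, so this congruence becomes the equality
    \<open>m0 = h0\<close>, which is what permits cancelling them exactly below.\<close>
  have "pcong p 1 m0 h0"
    by (rule pcongI[OF assms(1), of "h1 + P * b + G + P * d - n1 - P * a - m1 - P * c"])
      (use n0h0 a b c d G int P in \<open>auto simp: P_def[symmetric] algebra_simps power2_eq_square intro!: Zp\<close>)
  then have "[padic_digit p (n0 - 1) 0 = padic_digit p H 0] (mod p)"
    unfolding m0_def h0_def by (rule pcong_of_nat_cong[OF assms(1)])
  then have m0: "m0 = h0"
    unfolding m0_def h0_def
    using two_padic_digits(1)[OF assms(1) n0] two_padic_digits(1)[OF assms(1) H]
    by (simp add: cong_less_modulus_unique_nat)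
  \<comment> \<open>Modulo \<open>P^2\<close>, \<open>x - 1\<close> is
    \<open>m0 + P * (n1 + m1)\<close> and \<open>H\<close> is \<open>h0 + P * h1\<close>. The
    leading digits cancel, and one factor \<open>P\<close> can be removed.\<close>
  have "P * (n1 + m1) = P * (h1 + G + P * (b + d - a - c))"
    using a(2) b(2) c(2) d(2) m0 unfolding G_def[symmetric]
    by (simp add: algebra_simps power2_eq_square)
  then have eq: "n1 + m1 = h1 + G + P * (b + d - a - c)" using P by simp
  \<comment> \<open>Since \<open>H = h0 + P * g\<close>, replacing \<open>H\<close> by its leading
    digit inside \<open>G\<close> costs only a multiple of \<open>P\<close>.\<close>
  define g where "g = h1 + P * b"
  have g: "g \<in> p_integers p" "H = h0 + P * g"
    unfolding g_def b(2) using b(1) P int by (auto intro!: Zp simp: algebra_simps power2_eq_square)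
  have "n1 + m1 = 3 / 2 * h0 ^ 2 + h1 + h0 - A * (1 + h0) + 2
    + P * (3 * h0 * g + 3 * P * g ^ 2 / 2 + g - A * g + (b + d - a - c))"
    unfolding eq G_def g(2) by (simp add: field_simps power2_eq_square)
  moreover have "3 * h0 * g + 3 * P * g ^ 2 / 2 + g - A * g + (b + d - a - c) \<in> p_integers p"
    by (intro Zp half a b c d g A P int)
  ultimately have "pcong p 1 (n1 + m1) (3 / 2 * h0 ^ 2 + h1 + h0 - A * (1 + h0) + 2)"
    by (intro pcongI[OF assms(1)]) (auto simp: P_def)
  then show ?thesis
    using first unfolding n0_def n1_def m1_def h0_def h1_def x_def by blast
qed

end
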